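(* For all integers $p\ge0$ and $q\ge1$, the Taylor coefficient $e_{p,q}$ of the Virasoro function is an integral linear combination of multiple zeta values of weight $2p+3q$ and depth $\le q$ with last argument larger than $2p+2q$ and all other arguments equal to $1$ or $2$. More precisely, $$e_{p,q}=\sum_{r=0}^{q-1}(-1)^r\,C(p,q,r)\,Z(2p+3q-r,r),$$ where $$Z(k,r)=\sum_{\substack{j\ge0,\ (r_1,\dots,r_j)\in\{1,2\}^j\\ r_1+\cdots+r_j=r}}2^{\#\{i\,:\,r_i=1\}}\,\zeta(r_1,\dots,r_j,k)\qquad(k\ge2,\ r\ge0)$$ and the coefficients $C(p,q,r)$ are defined by the generating function $$\sum_{q=r+1}^\infty C(p,q,r)\,y^{q-1}=\frac{2+y}{(1-y)^{p+1}}\left(\frac{1-\sqrt{1-4y}}{2}\right)^r\qquad(r\in\mathbb{Z}_{\ge0},\ p\in\mathbb{Z}).$$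
   Context: Multiple zeta values: $\zeta(k_1,\ldots,k_m)=\sum_{0<n_1<\cdots<n_m}n_1^{-k_1}\cdots n_m^{-k_m}$ (positive integers $k_i$, $k_m\ge2$), of weight $k_1+\cdots+k_m$ and depth $m$. On $\{(s,t,u)\in\mathbb{C}^3: s+t+u=0\}$ the Virasoro function is $$V^{(\mathrm{cl})}(s,t,u)=\frac{\Gamma(1+s)\,\Gamma(1+t)\,\Gamma(1+u)}{\Gamma(1-s)\,\Gamma(1-t)\,\Gamma(1-u)}.$$ Being symmetric in $s,t,u$, it can be written as $V^{(\mathrm{cl})}(s,t,u)=\widetilde V^{(\mathrm{cl})}(S,T)$ with $S=\tfrac12(s^2+t^2+u^2)=s^2+st+t^2$ and $T=-stu=st(s+t)$. The numbers $e_{p,q}$ are the coefficients of its Taylor expansion at the origin, $$\widetilde V^{(\mathrm{cl})}(S,T)=1+\sum_{p\ge0,\ q\ge1}e_{p,q}\,S^pT^q.$$ *)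

theory Defs
  imports
    "HOL-Analysis.Analysis"
    "HOL-Computational_Algebra.Fundamental_Theorem_Algebra"
begin

section \<open>Multiple zeta values\<close>

text \<open>
  The argument list is \<open>[k\<^sub>1, \<dots>, k\<^sub>m]\<close> and the summation is over \<open>0 < n\<^sub>1 < \<dots> < n\<^sub>m\<close>; the
  convergence condition is on the last argument. All terms are nonnegative, so the unconditional
  sum is the usual one.
\<close>

definition mzv :: "nat list \<Rightarrow> real" where
  "mzv ks = (\<Sum>\<^sub>\<infinity> ns \<in> {ns :: nat list. length ns = length ks \<and>
                            sorted_wrt (<) ns \<and> (\<forall>n\<in>set ns. 0 < n)}.
               \<Prod>i<length ks. 1 / real (ns ! i) ^ (ks ! i))"

definition Z_sum :: "nat \<Rightarrow> nat \<Rightarrow> real" where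
  "Z_sum k r = (\<Sum>rs \<in> {rs. set rs \<subseteq> {1, 2} \<and> sum_list rs = r}.
              2 ^ count_list rs 1 * mzv (rs @ [k]))"

definition mzv_indices :: "nat \<Rightarrow> nat \<Rightarrow> nat list set" where
  "mzv_indices p q = {ks. ks \<noteq> [] \<and> sum_list ks = 2 * p + 3 * q \<and> length ks \<le> q \<and>
                          2 * p + 2 * q < last ks \<and> set (butlast ks) \<subseteq> {1, 2}}"


text \<open>The index sets of the finite sums are indeed finite.\<close>

lemma finite_Z_indices: "finite {rs :: nat list. set rs \<subseteq> {1, 2} \<and> sum_list rs = r}"
proof (rule finite_subset)
  show "{rs :: nat list. set rs \<subseteq> {1, 2} \<and> sum_list rs = r}
          \<subseteq> {rs. set rs \<subseteq> {1, 2} \<and> length rs \<le> r}"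
  proof safe
    fix rs :: "nat list"
    assume "set rs \<subseteq> {1, 2}"
    then show "length rs \<le> sum_list rs"
      by (induction rs) auto
  qed
  show "finite {rs :: nat list. set rs \<subseteq> {1, 2} \<and> length rs \<le> r}"
    by (rule finite_lists_length_le) simp
qed

lemma finite_mzv_indices: "finite (mzv_indices p q)"
proof (rule finite_subset)
  show "mzv_indices p q \<subseteq> {ks. set ks \<subseteq> {..2 * p + 3 * q} \<and> length ks \<le> q}"
    by (auto simp: mzv_indices_def dest: member_le_sum_list)
  show "finite {ks. set ks \<subseteq> {..2 * p + 3 * q} \<and> length ks \<le> q}"
    by (rule finite_lists_length_le) simp
qed


section \<open>The coefficients \<open>C(p,q,r)\<close>\<close>

text \<open>
  The generating function is a formal power series in \<open>y\<close>. \<open>fps_radical root 2\<close> is the square root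
  whose constant term is the real square root of the constant term of its argument.
\<close>

definition sqrt_1_minus_4y :: "real fps" where
  "sqrt_1_minus_4y = fps_radical root 2 (1 - 4 * fps_X)"

definition C_gf :: "int \<Rightarrow> nat \<Rightarrow> real fps" where
  "C_gf p r = (2 + fps_X) / ((1 - fps_X) powi (p + 1)) * ((1 - sqrt_1_minus_4y) / 2) ^ r"

text \<open>Meaningful for \<open>q > r\<close>, in particular \<open>q \<ge> 1\<close>.\<close>

definition C_coeff :: "int \<Rightarrow> nat \<Rightarrow> nat \<Rightarrow> real" where
  "C_coeff p q r = fps_nth (C_gf p r) (q - 1)"

lemma sqrt_1_minus_4y:
  "sqrt_1_minus_4y ^ 2 = 1 - 4 * fps_X" "fps_nth sqrt_1_minus_4y 0 = 1"
proof -
  show "fps_nth sqrt_1_minus_4y 0 = 1"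
    by (simp add: sqrt_1_minus_4y_def)
  show "sqrt_1_minus_4y ^ 2 = 1 - 4 * fps_X"
    using power_radical[of "1 - 4 * fps_X :: real fps" root 1]
    by (simp add: sqrt_1_minus_4y_def numeral_2_eq_2)
qed

text \<open>The generating function has no terms \<open>y\<^sup>n\<close> with \<open>n < r\<close>.\<close>

lemma C_gf_eq: "C_gf p r = Abs_fps (\<lambda>n. if r \<le> n then C_coeff p (n + 1) r else 0)"
proof (rule fps_ext)
  fix n
  define h :: "real fps" where "h = (1 - sqrt_1_minus_4y) / 2"
  have "fps_nth h 0 = 0"
    by (simp add: h_def sqrt_1_minus_4y(2) fps_divide_unit)
  then have "fps_nth (h ^ r) i = 0" if "i < r" for i
    using that by (intro startsby_zero_power_prefix[rule_format]) auto
  then have "fps_nth (C_gf p r) n = 0" if "n < r"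
    using that unfolding C_gf_def h_def[symmetric] fps_mult_nth
    by (intro sum.neutral) auto
  then show "fps_nth (C_gf p r) n =
      fps_nth (Abs_fps (\<lambda>n. if r \<le> n then C_coeff p (n + 1) r else 0)) n"
    by (auto simp: C_coeff_def)
qed


section \<open>The Virasoro function and its Taylor coefficients\<close>

definition virasoro :: "complex \<Rightarrow> complex \<Rightarrow> complex \<Rightarrow> complex" where
  "virasoro s t u =
     (Gamma (1 + s) * Gamma (1 + t) * Gamma (1 + u)) /
     (Gamma (1 - s) * Gamma (1 - t) * Gamma (1 - u))"

definition virasoro_tilde :: "complex \<Rightarrow> complex \<Rightarrow> complex" where
  "virasoro_tilde S T = (THE v. \<exists>s t u. s + t + u = 0 \<and>
     S = (s\<^sup>2 + t\<^sup>2 + u\<^sup>2) / 2 \<and> T = - (s * t * u) \<and> v = virasoro s t u)"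

text \<open>\<open>virasoro_tilde\<close> is well defined on all of \<open>\<complex>\<^sup>2\<close>.\<close>

lemma virasoro_tilde_exists:
  fixes S T :: complex
  shows "\<exists>s t u. s + t + u = 0 \<and> S = (s\<^sup>2 + t\<^sup>2 + u\<^sup>2) / 2 \<and> T = - (s * t * u)"
proof -
  have "\<exists>s. poly [:T, - S, 0, 1:] s = 0"
    by (rule alg_closed_imp_poly_has_root) simp
  then obtain s where s: "T - S * s + s ^ 3 = 0"
    by (auto simp: algebra_simps power3_eq_cube)
  have "\<exists>t. poly [:s\<^sup>2 - S, s, 1:] t = 0"
    by (rule alg_closed_imp_poly_has_root) simp
  then obtain t where t: "t\<^sup>2 + s * t + s\<^sup>2 - S = 0"
    by (auto simp: algebra_simps power2_eq_square)
  have S: "S = t\<^sup>2 + s * t + s\<^sup>2"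
    using t by (simp add: algebra_simps)
  have "S = (s\<^sup>2 + t\<^sup>2 + (- s - t)\<^sup>2) / 2"
    by (simp add: S power2_eq_square field_simps)
  moreover have "T = - (s * t * (- s - t))"
    using s S by algebra
  ultimately show ?thesis
    by (intro exI[of _ s] exI[of _ t] exI[of _ "- s - t"]) simp
qed

lemma virasoro_unique:
  fixes s t u s' t' u' :: complex
  assumes "s + t + u = 0" "s' + t' + u' = 0"
    and "s\<^sup>2 + t\<^sup>2 + u\<^sup>2 = s'\<^sup>2 + t'\<^sup>2 + u'\<^sup>2" "s * t * u = s' * t' * u'"
  shows "virasoro s t u = virasoro s' t' u'"
proof -
  have u: "u = - s - t" and u': "u' = - s' - t'"
    using assms(1,2) by (simp_all add: add_eq_0_iff algebra_simps)
  have comm: "- t - s = - s - t"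
    by simp
  have "2 * (s\<^sup>2 + s * t + t\<^sup>2) = 2 * (s'\<^sup>2 + s' * t' + t'\<^sup>2)"
    using assms(3) by (simp add: u u' power2_eq_square algebra_simps)
  then have S: "s\<^sup>2 + s * t + t\<^sup>2 = s'\<^sup>2 + s' * t' + t'\<^sup>2"
    by (rule mult_left_cancel[THEN iffD1, rotated]) simp
  have T: "s * t * (s + t) = s' * t' * (s' + t')"
    using assms(4) by (simp add: u u' algebra_simps)
  have "(s' - s) * (s' - t) * (s' + s + t) = 0"
    using S T by algebra
  then have "s' = s \<or> s' = t \<or> s' + s + t = 0"
    by simp
  moreover have "s' = u" if "s' + s + t = 0"
    using that unfolding u by algebra
  ultimately consider "s' = s" | "s' = t" | "s' = u"
    by blast
  then show ?thesis
  proof cases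
    case 1
    have "(t' - t) * (t' + s + t) = 0"
      using S unfolding 1 by algebra
    then have "t' = t \<or> t' + s + t = 0"
      by simp
    moreover have "t' = u" if "t' + s + t = 0"
      using that unfolding u by algebra
    ultimately have "t' = t \<or> t' = u"
      by blast
    then show ?thesis
      using 1 by (auto simp: virasoro_def u u' comm mult_ac)
  next
    case 2
    have "(t' - s) * (t' + s + t) = 0"
      using S unfolding 2 by algebra
    then have "t' = s \<or> t' + s + t = 0"
      by simp
    moreover have "t' = u" if "t' + s + t = 0"
      using that unfolding u by algebra
    ultimately have "t' = s \<or> t' = u"
      by blast
    then show ?thesis
      using 2 by (auto simp: virasoro_def u u' comm mult_ac)
  next
    case 3
    have "(t' - s) * (t' - t) = 0"
      using S unfolding 3 u by algebra
    then have "t' = s \<or> t' = t"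
      by auto
    then show ?thesis
      using 3 by (auto simp: virasoro_def u u' comm mult_ac)
  qed
qed

lemma virasoro_tilde_eq:
  assumes "s + t + u = 0"
  shows "virasoro_tilde ((s\<^sup>2 + t\<^sup>2 + u\<^sup>2) / 2) (- (s * t * u)) = virasoro s t u"
  unfolding virasoro_tilde_def
proof (rule the_equality)
  show "\<exists>s' t' u'. s' + t' + u' = 0 \<and> (s\<^sup>2 + t\<^sup>2 + u\<^sup>2) / 2 = (s'\<^sup>2 + t'\<^sup>2 + u'\<^sup>2) / 2 \<and>
          - (s * t * u) = - (s' * t' * u') \<and> virasoro s t u = virasoro s' t' u'"
    using assms by blast
next
  fix v
  assume "\<exists>s' t' u'. s' + t' + u' = 0 \<and> (s\<^sup>2 + t\<^sup>2 + u\<^sup>2) / 2 = (s'\<^sup>2 + t'\<^sup>2 + u'\<^sup>2) / 2 \<and>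
          - (s * t * u) = - (s' * t' * u') \<and> v = virasoro s' t' u'"
  then obtain s' t' u' where *: "s' + t' + u' = 0"
      "(s\<^sup>2 + t\<^sup>2 + u\<^sup>2) / 2 = (s'\<^sup>2 + t'\<^sup>2 + u'\<^sup>2) / 2"
      "- (s * t * u) = - (s' * t' * u')" "v = virasoro s' t' u'"
    by blast
  from *(2) have "s\<^sup>2 + t\<^sup>2 + u\<^sup>2 = s'\<^sup>2 + t'\<^sup>2 + u'\<^sup>2"
    by (simp only: divide_cancel_right) simp
  with * have "virasoro s t u = virasoro s' t' u'"
    using assms by (intro virasoro_unique) (simp_all only: neg_equal_iff_equal)
  then show "v = virasoro s t u"
    using *(4) by simp
qed

text \<open>
  The coefficient of \<open>S\<^sup>p T\<^sup>q\<close> in the Taylor expansion at the origin: the iterated partial derivative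
  \<open>\<partial>\<^sub>S\<^sup>p \<partial>\<^sub>T\<^sup>q\<close> at \<open>(0, 0)\<close> divided by \<open>p! q!\<close>.
\<close>

definition e_coeff :: "nat \<Rightarrow> nat \<Rightarrow> complex" where
  "e_coeff p q =
     (deriv ^^ p) (\<lambda>S. (deriv ^^ q) (\<lambda>T. virasoro_tilde S T) 0) 0 / (fact p * fact q)"

end

(*
  The denominator n^3 - n S - T of the n-th factor of the product
    V(S,T) = prod_{n>=1} (n^3 - n S + T) / (n^3 - n S - T)
  vanishes at S = n^2 - T/n, and V tends to 1 as S grows with T fixed. The partial fraction
  expansion in S (expanding in T instead would diverge) has residues that telescope, which gives,
  with y = T/n^3 and y = x (1 - x),
    V(S,T) = 1 + sum_n y (2 + y) / (1 - y - S/n^2) prod_{0<m<n} (1 - n x/m)^2.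
  Here prod_{0<m<n} (1 - n x/m)^2 = prod_{0<m<n} (1 - n^2 y / (m (n - m))) by symmetry under
  m -> n - m. Taking the coefficient of S^p T^q and expanding prod_{0<m<n} (1 - n x/m)^2 in powers
  of x, where truncated multiple zeta values with arguments 1 and 2 appear, gives the formula.
*)

theory Submission
  imports Defs "HOL-Complex_Analysis.Complex_Analysis" "HOL-Real_Asymp.Real_Asymp"
begin

text \<open>Partial fractions are exact only for finitely many factors, so the product is cut off at
  m = N. The cutoff leaves the telescoping incomplete: the n-th residue carries a spurious
  denominator built from the n indices N - n + 1, ..., N. It tends to 1 for fixed n, but n runs up
  to N, so Tannery's theorem is applied with a lower bound for this denominator that is uniform in n
  and N. The bidisc |S|, |T| \<le> 1/4 is small enough that the poles in S are distinct, that S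
  avoids them, and that the geometric series in S converge. The coefficient of S^p T^q is an
  iterated derivative, taken in T first. The coefficients of the expansion in S are holomorphic in
  T, so termwise differentiation in T leaves a power series in S from which the coefficient is read
  off. Signs and last arguments have one source: x enters as -n x, so the coefficient of x^r brings
  (-n)^r, which gives the sign (-1)^r and lowers the exponent of n from 2p + 3q to 2p + 3q -
  r.\<close>

section \<open>Partial fractions\<close>

text \<open>Multiplying by the factor of a new index \<open>k\<close> rescales each old residue, and
  the residue at the new pole contains the old product evaluated at \<open>b k\<close>. The
  induction hypothesis is therefore used at two points, \<open>z\<close> and \<open>b k\<close>,
  which is why \<open>z\<close> is arbitrary.\<close>

lemma prod_partial_fractions:
  fixes a b :: "'i \<Rightarrow> 'a :: field"
  assumes "finite A" "inj_on b A" "z \<notin> b ` A"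
  shows "(\<Prod>i\<in>A. (a i - z) / (b i - z)) =
           1 + (\<Sum>i\<in>A. (a i - b i) / (b i - z) * (\<Prod>j\<in>A - {i}. (a j - b i) / (b j - b i)))"
  using assms
proof (induction A arbitrary: z rule: finite_induct)
  case (insert k A)
  define r where "r i = (a i - b i) * (\<Prod>j\<in>A - {i}. (a j - b i) / (b j - b i))" for i
  have IH: "(\<Prod>i\<in>A. (a i - w) / (b i - w)) = 1 + (\<Sum>i\<in>A. r i / (b i - w))" if "w \<notin> b ` A" for w
    using insert that by (simp add: r_def)
  have k: "b k - z \<noteq> 0" and kA: "b k \<notin> b ` A" and zA: "z \<notin> b ` A"
    using insert by auto
  have split: "r i / (b i - z) * ((a k - z) / (b k - z)) =
      (a i - b i) / (b i - z) * (\<Prod>j\<in>insert k A - {i}. (a j - b i) / (b j - b i)) +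
      (a k - b k) / (b k - z) * (r i / (b i - b k))" if i: "i \<in> A" for i
  proof -
    have nz: "b i - z \<noteq> 0" "b k - b i \<noteq> 0" "b i - b k \<noteq> 0"
      using i kA zA by (auto simp: image_iff)
    have "insert k A - {i} = insert k (A - {i})"
      using i insert by auto
    then have "(\<Prod>j\<in>insert k A - {i}. (a j - b i) / (b j - b i)) =
        (a k - b i) / (b k - b i) * (\<Prod>j\<in>A - {i}. (a j - b i) / (b j - b i))"
      using insert by simp
    then have *: "(a i - b i) / (b i - z) * (\<Prod>j\<in>insert k A - {i}. (a j - b i) / (b j - b i)) =
        r i / (b i - z) * ((a k - b i) / (b k - b i))"
      by (simp add: r_def)
    \<comment> \<open>Partial fractions with two poles; the last term, summed over \<open>i\<close>,
      builds up the residue at \<open>b k\<close>.\<close>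
    have "1 / (b i - z) * ((a k - z) / (b k - z)) =
        1 / (b i - z) * ((a k - b i) / (b k - b i)) + (a k - b k) / (b k - z) * (1 / (b i - b k))"
      using k nz by (simp add: divide_simps) (simp add: algebra_simps)
    then have "r i * (1 / (b i - z) * ((a k - z) / (b k - z))) =
        r i * (1 / (b i - z) * ((a k - b i) / (b k - b i)) +
          (a k - b k) / (b k - z) * (1 / (b i - b k)))"
      by simp
    then show ?thesis
      unfolding * by (simp add: algebra_simps)
  qed
  have "(\<Prod>i\<in>insert k A. (a i - z) / (b i - z)) =
      (1 + (\<Sum>i\<in>A. r i / (b i - z))) * ((a k - z) / (b k - z))"
    using insert IH[OF zA] by simp
  also have "\<dots> = (a k - z) / (b k - z) + (\<Sum>i\<in>A. r i / (b i - z) * ((a k - z) / (b k - z)))"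
    by (simp only: distrib_right mult_1_left sum_distrib_right)
  also have "(\<Sum>i\<in>A. r i / (b i - z) * ((a k - z) / (b k - z))) =
      (\<Sum>i\<in>A. (a i - b i) / (b i - z) * (\<Prod>j\<in>insert k A - {i}. (a j - b i) / (b j - b i))) +
      (a k - b k) / (b k - z) * (\<Sum>i\<in>A. r i / (b i - b k))"
    by (simp only: split sum.distrib sum_distrib_left cong: sum.cong)
  also have "(\<Sum>i\<in>A. r i / (b i - b k)) = (\<Prod>i\<in>A. (a i - b k) / (b i - b k)) - 1"
    using IH[OF kA] by simp
  also have "(\<Prod>i\<in>A. (a i - b k) / (b i - b k)) = (\<Prod>j\<in>insert k A - {k}. (a j - b k) / (b j - b k))"
    using insert by simp
  also have "(a k - z) / (b k - z) = 1 + (a k - b k) / (b k - z)"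
    using k by (simp add: divide_simps)
  finally have "(\<Prod>i\<in>insert k A. (a i - z) / (b i - z)) =
      1 + ((a k - b k) / (b k - z) * (\<Prod>j\<in>insert k A - {k}. (a j - b k) / (b j - b k)) +
        (\<Sum>i\<in>A. (a i - b i) / (b i - z) * (\<Prod>j\<in>insert k A - {i}. (a j - b i) / (b j - b i))))"
    by (simp only: right_diff_distrib mult_1_right) simp
  then show ?case
    by (simp only: sum.insert[OF insert.hyps])
qed auto

section \<open>Residues of the truncated product and their telescoping\<close>

definition res_poly :: "nat \<Rightarrow> 'a :: field_char_0 \<Rightarrow> 'a" where
  "res_poly n c = (\<Prod>m=1..<n. 1 - c / (of_nat m * of_nat (n - m)))"

text \<open>The numerator has the factor m + n and the denominator the factor m - n. What remains is
  f(m - n) / f(m) with f(i) = 1 + c / (i (i + n)), a shift by n; this is why the residues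
  telescope.\<close>

lemma residue_product_aux:
  fixes c m n :: "'a :: field"
  assumes "m \<noteq> n" "m \<noteq> 0" "m + n \<noteq> 0" "m\<^sup>2 + m * n + c \<noteq> 0" "n \<noteq> 0"
  shows "((m\<^sup>2 + n * c / m) - (n\<^sup>2 - c)) / ((m\<^sup>2 - n * c / m) - (n\<^sup>2 - c)) =
      (1 + c / ((m - n) * m)) / (1 + c / (m * (m + n)))"
proof -
  have 1: "(m\<^sup>2 + n * c / m) - (n\<^sup>2 - c) = (m + n) * (m * (m - n) + c) / m"
    using assms by (simp add: field_simps power2_eq_square)
  have 2: "(m\<^sup>2 - n * c / m) - (n\<^sup>2 - c) = (m - n) * (m * (m + n) + c) / m"
    using assms by (simp add: field_simps power2_eq_square)
  have 3: "m * (m + n) + c \<noteq> 0"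
    using assms by (simp add: power2_eq_square algebra_simps)
  have 4: "1 + c / ((m - n) * m) = (m * (m - n) + c) / ((m - n) * m)"
    using assms by (simp add: field_simps)
  have 5: "1 + c / (m * (m + n)) = (m * (m + n) + c) / (m * (m + n))"
    by (subst add_divide_distrib) (use assms in simp)
  show ?thesis
    unfolding 1 2 4 5 using assms 3 by (simp add: field_simps)
qed

text \<open>
  Here \<open>c = T / n\<close>, so that \<open>n\<^sup>2 \<plusminus> c\<close> are the values of \<open>S\<close> at which \<open>n\<^sup>3 - n S \<plusminus> T\<close> vanishes.
  As \<open>N\<close> grows, the denominator tends to 1.
\<close>

lemma residue_product:
  fixes c :: "'a :: field_char_0"
  assumes n: "1 \<le> n" "n \<le> N"
    and nz: "\<And>m. m \<ge> 1 \<Longrightarrow> of_nat m ^ 2 + of_nat m * of_nat n + c \<noteq> 0"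
  shows "2 * c * (\<Prod>m\<in>{1..N} - {n}.
            ((of_nat m ^ 2 + of_nat n * c / of_nat m) - (of_nat n ^ 2 - c)) /
            ((of_nat m ^ 2 - of_nat n * c / of_nat m) - (of_nat n ^ 2 - c))) =
         c * (2 + c / of_nat n ^ 2) * res_poly n c /
           (\<Prod>j<n. 1 + c / (of_nat (N - j) * of_nat (N - j + n)))"
    (is "_ * ?P N = ?C / ?Q N")
proof -
  define k where "k i = 1 + c / (of_nat i * of_nat (i + n))" for i
  have knz: "k i \<noteq> 0" if "i \<ge> 1" for i
  proof -
    have "k i = (of_nat i ^ 2 + of_nat i * of_nat n + c) / (of_nat i * of_nat (i + n))"
      using that by (simp add: k_def field_simps power2_eq_square del: of_nat_add)
         (simp add: field_simps)
    then show ?thesis using nz[OF that] that by (simp del: of_nat_add)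
  qed
  from n(2) show ?thesis
  proof (induction N rule: dec_induct)
  case base
  have "{1..n} - {n} = {1..<n}"
    by auto
  \<comment> \<open>For m < n the shifted index m - n is negative, and the numerator is 1 - c / (m
    (n - m)), a factor of \<open>res_poly\<close>.\<close>
  then have "?P n = (\<Prod>m=1..<n. (1 - c / (of_nat m * of_nat (n - m))) / k m)"
  proof (intro prod.cong, goal_cases)
    case (2 m)
    then have "m \<noteq> n" "m \<ge> 1" and m: "m < n" by auto
    then have "(of_nat m :: 'a) \<noteq> of_nat n" "(of_nat m :: 'a) \<noteq> 0" "(of_nat n :: 'a) \<noteq> 0"
      "of_nat m + of_nat n \<noteq> (0 :: 'a)"
      using n by (auto simp flip: of_nat_add)
    from residue_product_aux[OF this(1,2,4) nz[OF \<open>m \<ge> 1\<close>] this(3)] this m show ?case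
      by (simp add: k_def of_nat_diff minus_divide_right[symmetric] flip: minus_divide_right)
         (simp add: field_simps)
  qed auto
  also have "\<dots> = res_poly n c / (\<Prod>m=1..<n. k m)"
    by (simp add: prod_dividef res_poly_def)
  finally have P: "?P n = res_poly n c / (\<Prod>m=1..<n. k m)" .
  have "?Q n = (\<Prod>i\<in>{1..n}. k i)"
    unfolding k_def by (rule prod.reindex_bij_witness[of _ "\<lambda>i. n - i" "\<lambda>i. n - i"]) auto
  also have "{1..n} = insert n {1..<n}"
    using n by auto
  finally have Q: "?Q n = k n * (\<Prod>m=1..<n. k m)"
    by simp
  \<comment> \<open>The index m = n is left out of the product, so \<open>k n\<close> survives;
    together with the factor 2 it makes 2 + c / n^2, which is 2 + y.\<close>
  have "k n = (2 + c / of_nat n ^ 2) / 2"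
    using n by (simp add: k_def field_simps power2_eq_square)
  then have k: "2 + c / of_nat n ^ 2 = 2 * k n"
    by (simp only:) simp
  moreover have "k n \<noteq> 0" "(\<Prod>m=1..<n. k m) \<noteq> 0"
    using knz n by auto
  ultimately show ?case
    unfolding P Q k by simp
next
  case (step N)
  define m where "m = Suc N"
  have m: "m > n" using step by (simp add: m_def)
  have f: "((of_nat m ^ 2 + of_nat n * c / of_nat m) - (of_nat n ^ 2 - c)) /
            ((of_nat m ^ 2 - of_nat n * c / of_nat m) - (of_nat n ^ 2 - c)) = k (m - n) / k m"
  proof -
    have "m \<noteq> n" "m \<ge> 1" using m by auto
    then have "(of_nat m :: 'a) \<noteq> of_nat n" "(of_nat m :: 'a) \<noteq> 0" "(of_nat n :: 'a) \<noteq> 0"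
      "of_nat m + of_nat n \<noteq> (0 :: 'a)"
      using n by (auto simp flip: of_nat_add)
    from residue_product_aux[OF this(1,2,4) nz[OF \<open>m \<ge> 1\<close>] this(3)] this m show ?thesis
      by (simp add: k_def of_nat_diff)
  qed
  have Qk: "?Q M = (\<Prod>j<n. k (M - j))" for M
    by (simp add: k_def)
  \<comment> \<open>\<open>?Q N\<close> is a window of n consecutive values of \<open>k\<close>
    ending at N; moving it up by one gains \<open>k m\<close> and loses
    \<open>k (m - n)\<close>.\<close>
  have "?Q (Suc N) * k (m - n) = ?Q N * k m"
  proof -
    have "?Q (Suc N) * k (m - n) = (\<Prod>j<Suc n. k (m - j))"
      unfolding Qk m_def by simp
    also have "\<dots> = k m * ?Q N"
      unfolding Qk by (subst prod.lessThan_Suc_shift) (simp add: m_def)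
    finally show ?thesis by (simp add: mult.commute)
  qed
  moreover have "k m \<noteq> 0" "k (m - n) \<noteq> 0" "?Q N \<noteq> 0" "?Q (Suc N) \<noteq> 0"
    using knz m n step unfolding Qk by auto
  ultimately have Q: "k (m - n) / (k m * ?Q N) = 1 / ?Q (Suc N)"
    by (simp add: field_simps)
  have "{1..Suc N} - {n} = insert m ({1..N} - {n})"
    using step n by (auto simp: m_def)
  then have "2 * c * ?P (Suc N) = k (m - n) / k m * (2 * c * ?P N)"
    using f by (simp add: m_def)
  also have "\<dots> = ?C * (k (m - n) / (k m * ?Q N))"
    by (subst step.IH) simp
  also have "\<dots> = ?C / ?Q (Suc N)"
    unfolding Q by simp
  finally show ?case .
qed
qed

section \<open>Uniform estimates and the limit of the truncated expansion\<close>

lemma norm_res_poly_le: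
  fixes c :: complex
  assumes "norm c \<le> 1 / of_nat n"
  shows "norm (res_poly n c) \<le> 3"
proof (cases "n = 0")
  case False
  have "norm (res_poly n c) = (\<Prod>m=1..<n. norm (1 - c / (of_nat m * of_nat (n - m))))"
    by (simp add: res_poly_def prod_norm)
  \<comment> \<open>Since m (n - m) \<ge> 1, no factor exceeds 1 + 1 / n; there are n - 1 of them,
    so the bound e does not depend on n.\<close>
  also have "\<dots> \<le> (\<Prod>m=1..<n. exp (1 / real n))"
  proof (intro prod_mono conjI)
    fix m assume m: "m \<in> {1..<n}"
    define k where "k = m * (n - m)"
    have "k \<ge> 1"
      using m by (simp add: k_def Suc_le_eq)
    then have "norm c / real k \<le> norm c / 1"
      by (intro divide_left_mono) auto
    then have "norm (c / of_nat k) \<le> 1 / n"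
      using assms by (simp only: norm_divide norm_of_nat)
    then have "norm (c / (of_nat m * of_nat (n - m))) \<le> 1 / n"
      by (simp only: k_def of_nat_mult)
    then have "norm (1 - c / (of_nat m * of_nat (n - m))) \<le> 1 + 1 / n"
      using norm_triangle_ineq4[of 1 "c / (of_nat m * of_nat (n - m))"] by simp
    also have "\<dots> \<le> exp (1 / real n)"
      by (rule exp_ge_add_one_self)
    finally show "norm (1 - c / (of_nat m * of_nat (n - m))) \<le> exp (1 / real n)" .
  qed auto
  also have "\<dots> = exp (real (n - 1) * (1 / n))"
    by (subst exp_of_nat_mult) simp
  also have "\<dots> \<le> exp 1"
    using False by (subst exp_le_cancel_iff) (auto simp: field_simps)
  also have "\<dots> \<le> 3"
    by (rule exp_le)
  finally show ?thesis .
qed (simp add: res_poly_def)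

text \<open>Each of the n factors differs from 1 by at most 1 / (4 n^2), because (N - j) (N - j + n)
  \<ge> n. Bernoulli's inequality then bounds the product below by 1 - 1 / (4 n), uniformly in
  N.\<close>

lemma norm_correction_ge:
  fixes c :: complex
  assumes n: "1 \<le> n" "n \<le> N" and c: "norm c \<le> 1 / (4 * of_nat n)"
  shows "norm (\<Prod>j<n. 1 + c / (of_nat (N - j) * of_nat (N - j + n))) \<ge> 1 / 2"
proof -
  define x where "x = 1 / (4 * real n)"
  have x: "0 \<le> x" "x \<le> 1 / 4"
    using n by (auto simp: x_def field_simps)
  have "1 + real n * (- (x / n)) \<le> (1 + - (x / n)) ^ n"
  proof (rule Bernoulli_inequality)
    have "x / n \<le> x / 1"
      using n x by (intro divide_left_mono) auto
    then show "- 1 \<le> - (x / real n)"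
      using x by simp
  qed
  then have "1 / 2 \<le> (1 - x / n) ^ n"
    using n x by simp
  also have "\<dots> = (\<Prod>j<n. 1 - x / n)"
    by simp
  also have "\<dots> \<le> (\<Prod>j<n. norm (1 + c / (of_nat (N - j) * of_nat (N - j + n))))"
  proof (intro prod_mono conjI)
    fix j assume j: "j \<in> {..<n}"
    have "x / n \<le> x / 1"
      using n x by (intro divide_left_mono) auto
    then show "0 \<le> 1 - x / n"
      using x by simp
    define k where "k = (N - j) * (N - j + n)"
    have "1 * n \<le> k"
      unfolding k_def using j n by (intro mult_mono) auto
    then have "norm c / real k \<le> norm c / n"
      using n by (intro divide_left_mono mult_pos_pos) auto
    also have "\<dots> \<le> x / n"
      using c by (intro divide_right_mono) (auto simp: x_def)
    finally have "norm (c / of_nat k) \<le> x / n"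
      by (simp only: norm_divide norm_of_nat)
    then have "norm (c / (of_nat (N - j) * of_nat (N - j + n))) \<le> x / n"
      by (simp only: k_def of_nat_mult)
    then show "1 - x / n \<le> norm (1 + c / (of_nat (N - j) * of_nat (N - j + n)))"
      using norm_diff_ineq[of 1 "c / (of_nat (N - j) * of_nat (N - j + n))"] by simp
  qed
  finally show ?thesis
    by (simp add: prod_norm)
qed

lemma correction_tendsto:
  fixes c :: complex
  shows "(\<lambda>N. \<Prod>j<n. 1 + c / (of_nat (N - j) * of_nat (N - j + n))) \<longlonglongrightarrow> 1"
proof -
  have "(\<lambda>N. 1 + c / (of_nat (N - j) * of_nat (N - j + n))) \<longlonglongrightarrow> 1" for j
  proof -
    have "(\<lambda>N. 1 + c * (1 / (of_nat N * of_nat (N + n)))) \<longlonglongrightarrow> 1 + c * 0"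
    proof (intro tendsto_intros Lim_null_comparison[OF _ lim_1_over_n])
      show "\<forall>\<^sub>F N in sequentially. norm (1 / (of_nat N * of_nat (N + n)) :: complex) \<le> 1 / real N"
        using eventually_ge_at_top[of 1]
      proof eventually_elim
        case (elim N)
        then have "1 / (real N * real (N + n)) \<le> 1 / real N"
          by (intro divide_left_mono) (auto intro!: mult_le_cancel_left1[THEN iffD2])
        then show ?case by (simp add: norm_divide norm_mult flip: of_nat_add)
      qed
    qed
    then have "(\<lambda>N. 1 + c / (of_nat N * of_nat (N + n))) \<longlonglongrightarrow> 1"
      by simp
    from filterlim_compose[OF this filterlim_minus_const_nat_at_top[of j]] show ?thesis by simp
  qed
  then have "(\<lambda>N. \<Prod>j<n. 1 + c / (of_nat (N - j) * of_nat (N - j + n))) \<longlonglongrightarrow> (\<Prod>j<n. 1)"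
    by (intro tendsto_prod)
  then show ?thesis by simp
qed

lemma cubic_factor_norm_ge:
  fixes S T :: complex
  assumes "n \<ge> 1" "norm S \<le> 1 / 4" "norm T \<le> 1 / 4"
  shows "norm (of_nat n ^ 2 - T / of_nat n - S) \<ge> of_nat n ^ 2 / 2"
proof -
  have n2: "1 \<le> real n ^ 2"
    using assms by (simp add: one_le_power)
  have "norm T / n \<le> norm T / 1"
    using assms by (intro divide_left_mono) auto
  then have "norm (T / of_nat n + S) \<le> 1 / 2"
    using assms norm_triangle_ineq[of "T / of_nat n" S] by (simp add: norm_divide)
  moreover have "norm (of_nat n ^ 2 :: complex) = real n ^ 2"
    by (simp add: norm_power)
  ultimately show ?thesis
    using norm_triangle_ineq2[of "of_nat n ^ 2" "T / of_nat n + S"] n2 by (simp add: algebra_simps)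
qed

text \<open>The term with \<open>n = 0\<close> vanishes because \<open>T / 0 = 0\<close>.\<close>

definition pole_term :: "complex \<Rightarrow> complex \<Rightarrow> nat \<Rightarrow> complex" where
  "pole_term S T n = T / of_nat n * (2 + T / of_nat n / of_nat n ^ 2) * res_poly n (T / of_nat n) /
     (of_nat n ^ 2 - T / of_nat n - S)"

lemma norm_pole_numerator_le:
  fixes T :: complex
  assumes "norm T \<le> 1 / 4"
  shows "norm (T / of_nat n * (2 + T / of_nat n / of_nat n ^ 2) * res_poly n (T / of_nat n)) \<le> 2 / real n"
proof (cases "n = 0")
  case False
  define c where "c = T / of_nat n"
  have "norm c \<le> 1 / 4 / n"
    unfolding c_def norm_divide norm_of_nat using assms by (intro divide_right_mono) auto
  then have c: "norm c \<le> 1 / (4 * real n)"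
    by simp
  moreover have "1 / (4 * real n) \<le> 1 / 4"
    using False by (simp add: field_simps)
  ultimately have c': "norm c \<le> 1 / 4"
    by linarith
  have "norm c / real n ^ 2 \<le> norm c / 1"
    using False by (intro divide_left_mono) (auto simp: one_le_power)
  then have "norm (2 + c / of_nat n ^ 2) \<le> 9 / 4"
    using c' norm_triangle_ineq[of 2 "c / of_nat n ^ 2"] by (simp add: norm_divide norm_power)
  moreover have "norm (res_poly n c) \<le> 3"
    using c False by (intro norm_res_poly_le order.trans[OF c]) (auto simp: field_simps)
  ultimately have "norm c * norm (2 + c / of_nat n ^ 2) * norm (res_poly n c) \<le> 1 / (4 * n) * (9 / 4) * 3"
    using c by (intro mult_mono) auto
  also have "\<dots> \<le> 2 / n"
    using False by (simp add: field_simps)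
  finally show ?thesis
    unfolding c_def[symmetric] norm_mult .
qed simp

lemma norm_pole_term_le:
  assumes "norm S \<le> 1 / 4" "norm T \<le> 1 / 4"
  shows "norm (pole_term S T n) \<le> 4 / real n ^ 2"
proof (cases "n = 0")
  case False
  have "norm (pole_term S T n) \<le> (2 / real n) / (real n ^ 2 / 2)"
    unfolding pole_term_def norm_divide
    using cubic_factor_norm_ge[of n S T] norm_pole_numerator_le[of T n] assms False
    by (intro frac_le) auto
  also have "\<dots> \<le> (2 / real n) / (real n / 2)"
    using False by (intro divide_left_mono) (auto simp: power2_eq_square)
  also have "\<dots> = 4 / real n ^ 2"
    by (simp add: power2_eq_square)
  finally show ?thesis .
qed (simp add: pole_term_def)

lemma cubic_prod_eq_sum_poles:
  fixes S T :: complex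
  assumes "norm S \<le> 1 / 4" "norm T \<le> 1 / 4"
  shows "(\<Prod>m=1..N. (of_nat m ^ 2 + T / of_nat m - S) / (of_nat m ^ 2 - T / of_nat m - S)) =
    1 + (\<Sum>n=1..N. pole_term S T n /
      (\<Prod>j<n. 1 + T / of_nat n / (of_nat (N - j) * of_nat (N - j + n))))"
proof -
  define a b :: "nat \<Rightarrow> complex" where "a m = of_nat m ^ 2 + T / of_nat m"
    and "b m = of_nat m ^ 2 - T / of_nat m" for m
  have Tn: "norm (T / of_nat n) \<le> 1 / 4" if "n \<ge> 1" for n
  proof -
    have "norm T / n \<le> norm T / 1"
      using that by (intro divide_left_mono) auto
    with assms have "norm T / n \<le> 1 / 4"
      by linarith
    then show ?thesis
      by (simp only: norm_divide norm_of_nat)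
  qed
  \<comment> \<open>Coinciding poles would give m^2 - n^2 = T / m - T / n, where the left side is a
    nonzero integer and the right side has norm at most 1/2.\<close>
  have "inj_on b {1..N}"
  proof (rule inj_onI, rule ccontr)
    fix m n assume mn: "m \<in> {1..N}" "n \<in> {1..N}" "b m = b n" "m \<noteq> n"
    have "m\<^sup>2 \<noteq> n\<^sup>2"
      using mn by (simp add: power_eq_iff_eq_base)
    then have "int m ^ 2 - int n ^ 2 \<noteq> 0"
      by (simp flip: of_nat_power)
    then have "1 \<le> norm (of_int (int m ^ 2 - int n ^ 2) :: complex)"
      by (subst norm_of_int) linarith
    also have "of_int (int m ^ 2 - int n ^ 2) = T / of_nat m - T / of_nat n"
      using mn by (simp add: b_def algebra_simps)
    also have "norm \<dots> \<le> 1 / 4 + 1 / 4"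
      using mn by (intro order.trans[OF norm_triangle_ineq4] add_mono Tn) auto
    finally show False by simp
  qed
  moreover have "S \<notin> b ` {1..N}"
  proof
    assume "S \<in> b ` {1..N}"
    then obtain n where "n \<ge> 1" "b n - S = 0"
      by auto
    with cubic_factor_norm_ge[of n S T] assms show False
      by (simp add: b_def)
  qed
  ultimately have "(\<Prod>m=1..N. (a m - S) / (b m - S)) =
      1 + (\<Sum>n=1..N. (a n - b n) / (b n - S) * (\<Prod>m\<in>{1..N} - {n}. (a m - b n) / (b m - b n)))"
    by (intro prod_partial_fractions) auto
  also have "(\<Sum>n=1..N. (a n - b n) / (b n - S) * (\<Prod>m\<in>{1..N} - {n}. (a m - b n) / (b m - b n))) =
    (\<Sum>n=1..N. pole_term S T n /
      (\<Prod>j<n. 1 + T / of_nat n / (of_nat (N - j) * of_nat (N - j + n))))"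
  proof (rule sum.cong)
    fix n assume n: "n \<in> {1..N}"
    define c where "c = T / of_nat n"
    have Tc: "T = of_nat n * c"
      using n by (simp add: c_def)
    have nz: "of_nat m ^ 2 + of_nat m * of_nat n + c \<noteq> 0" if "m \<ge> 1" for m
    proof
      assume "of_nat m ^ 2 + of_nat m * of_nat n + c = 0"
      then have "- c = of_nat (m ^ 2 + m * n)"
        by (simp add: add_eq_0_iff2 minus_equation_iff)
      then have "norm c = real (m ^ 2 + m * n)"
        by (metis norm_minus_cancel norm_of_nat)
      moreover have "real (m ^ 2 + m * n) \<ge> real 1"
        using that by (intro of_nat_mono) (simp add: Suc_le_eq)
      ultimately show False
        using Tn[of n] n by (simp add: c_def)
    qed
    have "2 * c * (\<Prod>m\<in>{1..N} - {n}. (a m - b n) / (b m - b n)) =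
        c * (2 + c / of_nat n ^ 2) * res_poly n c /
           (\<Prod>j<n. 1 + c / (of_nat (N - j) * of_nat (N - j + n)))"
      using residue_product[of n N c] n nz by (simp add: a_def b_def Tc)
    moreover have "a n - b n = 2 * c"
      by (simp add: a_def b_def c_def)
    ultimately show "(a n - b n) / (b n - S) * (\<Prod>m\<in>{1..N} - {n}. (a m - b n) / (b m - b n)) =
        pole_term S T n / (\<Prod>j<n. 1 + T / of_nat n / (of_nat (N - j) * of_nat (N - j + n)))"
      by (simp add: pole_term_def b_def flip: c_def) (simp add: field_simps)
  qed simp
  finally show ?thesis
    by (simp add: a_def b_def)
qed

lemma cubic_prod_tendsto:
  fixes S T :: complex
  assumes "norm S \<le> 1 / 4" "norm T \<le> 1 / 4"
  shows "(\<lambda>N. \<Prod>m=1..N. (of_nat m ^ 2 + T / of_nat m - S) / (of_nat m ^ 2 - T / of_nat m - S))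
           \<longlonglongrightarrow> 1 + (\<Sum>n. pole_term S T n)"
proof -
  define Q where "Q n N = (\<Prod>j<n. 1 + T / of_nat n / (of_nat (N - j) * of_nat (N - j + n)))" for n N
  \<comment> \<open>Padding with zeros for n > N turns the finite sums into series over a fixed
    index set, as Tannery's theorem requires.\<close>
  define A where "A n N = (if n \<in> {1..N} then pole_term S T n / Q n N else 0)" for n N
  have "(\<lambda>N. \<Sum>n. A n N) \<longlonglongrightarrow> (\<Sum>n. pole_term S T n)"
  proof (rule tannerys_theorem[THEN conjunct2, THEN conjunct2])
    show "(\<lambda>N. A n N) \<longlonglongrightarrow> pole_term S T n" for n
    proof (cases "n = 0")
      case False
      have "(\<lambda>N. pole_term S T n / Q n N) \<longlonglongrightarrow> pole_term S T n / 1"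
        unfolding Q_def by (intro tendsto_intros correction_tendsto) auto
      then have "(\<lambda>N. pole_term S T n / Q n N) \<longlonglongrightarrow> pole_term S T n"
        by simp
      then show ?thesis
        by (rule Lim_transform_eventually)
           (use False in \<open>auto simp: A_def intro!: eventually_mono[OF eventually_ge_at_top[of n]]\<close>)
    qed (simp add: A_def pole_term_def)
    show "\<forall>\<^sub>F (n, N) in sequentially \<times>\<^sub>F sequentially. norm (A n N) \<le> 8 / real n ^ 2"
    proof (intro always_eventually allI, clarify)
      fix n N
      show "norm (A n N) \<le> 8 / real n ^ 2"
      proof (cases "n \<in> {1..N}")
        case True
        have "norm T / n \<le> 1 / 4 / n"
          using assms by (intro divide_right_mono) auto
        then have "norm (Q n N) \<ge> 1 / 2"
          unfolding Q_def using True by (intro norm_correction_ge) (auto simp: norm_divide)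
        then have "norm (pole_term S T n) / norm (Q n N) \<le> (4 / real n ^ 2) / (1 / 2)"
          by (intro frac_le norm_pole_term_le assms) auto
        then show ?thesis
          using True by (simp add: A_def norm_divide)
      qed (auto simp: A_def)
    qed
    show "summable (\<lambda>n. 8 / real n ^ 2)"
      using summable_mult[OF inverse_power_summable[of 2, where 'a = real], of 8]
      by (simp add: divide_inverse)
  qed auto
  moreover have "(\<Sum>n. A n N) = (\<Sum>n=1..N. pole_term S T n / Q n N)" for N
    by (subst suminf_finite[of "{1..N}"]) (auto simp: A_def)
  ultimately have "(\<lambda>N. 1 + (\<Sum>n=1..N. pole_term S T n / Q n N)) \<longlonglongrightarrow> 1 + (\<Sum>n. pole_term S T n)"
    by (intro tendsto_intros) simp
  then show ?thesis
    using cubic_prod_eq_sum_poles[OF assms] by (simp add: Q_def)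
qed

section \<open>Taylor coefficients\<close>

lemma virasoro_tilde_tendsto:
  fixes S T :: complex
  assumes "norm S \<le> 1 / 4" "norm T \<le> 1 / 4"
  shows "(\<lambda>N. \<Prod>m=1..N. (of_nat m ^ 2 + T / of_nat m - S) / (of_nat m ^ 2 - T / of_nat m - S))
           \<longlonglongrightarrow> virasoro_tilde S T"
proof -
  obtain s t u where stu: "s + t + u = 0" "S = (s\<^sup>2 + t\<^sup>2 + u\<^sup>2) / 2" "T = - (s * t * u)"
    using virasoro_tilde_exists by blast
  have u: "u = - s - t"
    using stu(1) by (simp add: add_eq_0_iff algebra_simps)
  have S: "S = s\<^sup>2 + s * t + t\<^sup>2" and T: "T = s * t * (s + t)"
    unfolding stu(2,3) u by (simp_all add: power2_eq_square field_simps)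
  have minus: "(of_nat m - s) * (of_nat m - t) * (of_nat m - u) =
      of_nat m * (of_nat m ^ 2 + T / of_nat m - S)" if "m \<ge> 1" for m
  proof -
    have "of_nat m * ((of_nat m :: complex) ^ 2 + T / of_nat m - S) = of_nat m ^ 3 + T - of_nat m * S"
      using that by (simp add: algebra_simps power2_eq_square power3_eq_cube)
    then show ?thesis
      by (simp only:) (simp add: S T u algebra_simps power2_eq_square power3_eq_cube)
  qed
  have plus: "(of_nat m + s) * (of_nat m + t) * (of_nat m + u) =
      of_nat m * (of_nat m ^ 2 - T / of_nat m - S)" if "m \<ge> 1" for m
  proof -
    have "of_nat m * ((of_nat m :: complex) ^ 2 - T / of_nat m - S) = of_nat m ^ 3 - T - of_nat m * S"
      using that by (simp add: algebra_simps power2_eq_square power3_eq_cube)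
    then show ?thesis
      by (simp only:) (simp add: S T u algebra_simps power2_eq_square power3_eq_cube)
  qed
  \<comment> \<open>The product with minus signs is the cubic at -T, so the lower bound applies with
    T replaced by -T.\<close>
  have nz: "(of_nat m - s) * (of_nat m - t) * (of_nat m - u) \<noteq> 0" if "m \<ge> 1" for m
  proof -
    have "1 / 2 \<le> real m ^ 2 / 2"
      using that by (simp add: one_le_power)
    then show ?thesis
      using minus[OF that] cubic_factor_norm_ge[of m S "- T"] that assms by auto
  qed
  \<comment> \<open>\<open>Gamma\<close> has the value 0 at its poles, so this says that no 1 - z is
    a pole, and the limit of the quotient is the quotient of the limits.\<close>
  have not_pole: "Gamma (1 - z) \<noteq> 0" if "z \<in> {s, t, u}" for z
    unfolding Gamma_eq_zero_iff
  proof
    assume "1 - z \<in> \<int>\<^sub>\<le>\<^sub>0"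
    then obtain n where "1 - z = - of_nat n"
      by (elim nonpos_Ints_cases')
    then have "of_nat (Suc n) - z = 0"
      by (simp add: algebra_simps)
    with nz[of "Suc n"] that show False
      by auto
  qed
  let ?G = "\<lambda>z. Gamma_series z"
  have lim: "(\<lambda>N. ?G (1 + s) N * ?G (1 + t) N * ?G (1 + u) N /
      (?G (1 - s) N * ?G (1 - t) N * ?G (1 - u) N)) \<longlonglongrightarrow> virasoro s t u"
    unfolding virasoro_def using not_pole by (intro tendsto_intros) auto
  \<comment> \<open>\<open>pochhammer z (N + 1)\<close> has N + 1 factors, which is why the product
    runs to \<open>Suc N\<close>; the shift is undone at the end.\<close>
  have "?G (1 + s) N * ?G (1 + t) N * ?G (1 + u) N / (?G (1 - s) N * ?G (1 - t) N * ?G (1 - u) N) =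
      (\<Prod>m=1..Suc N. (of_nat m ^ 2 + T / of_nat m - S) / (of_nat m ^ 2 - T / of_nat m - S))"
    (is "?L = _") for N
  proof -
    define L :: complex where "L = of_real (ln (of_nat N))"
    define P where "P z = pochhammer z (N + 1)" for z :: complex
    define F where "F = (fact N :: complex)"
    \<comment> \<open>Both triples of exponents add up to 3 \<open>L\<close> because s + t + u = 0;
      so the exponentials cancel and only the Pochhammer symbols remain.\<close>
    have "exp ((1 + s) * L) * exp ((1 + t) * L) * exp ((1 + u) * L) =
        exp ((1 - s) * L) * exp ((1 - t) * L) * exp ((1 - u) * L)"
      unfolding u by (simp add: algebra_simps flip: exp_add)
    then have e1: "F ^ 3 * (exp ((1 + s) * L) * exp ((1 + t) * L) * exp ((1 + u) * L)) =
        F ^ 3 * (exp ((1 - s) * L) * exp ((1 - t) * L) * exp ((1 - u) * L))"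
      by simp
    have e2: "F ^ 3 * (exp ((1 - s) * L) * exp ((1 - t) * L) * exp ((1 - u) * L)) \<noteq> 0"
      by (simp add: F_def)
    have e3: "?L = F ^ 3 * (exp ((1 + s) * L) * exp ((1 + t) * L) * exp ((1 + u) * L)) /
        (P (1 + s) * P (1 + t) * P (1 + u)) /
        (F ^ 3 * (exp ((1 - s) * L) * exp ((1 - t) * L) * exp ((1 - u) * L)) /
        (P (1 - s) * P (1 - t) * P (1 - u)))"
      by (simp add: Gamma_series_def P_def L_def F_def power3_eq_cube mult_ac)
    have cancel: "x / p / (y / p') = p' / p" if "x = y" "y \<noteq> 0" for x y p p' :: complex
      using that by simp
    have "?L = (P (1 - s) * P (1 - t) * P (1 - u)) / (P (1 + s) * P (1 + t) * P (1 + u))"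
      unfolding e3 by (rule cancel[OF e1 e2])
    moreover have "P (1 + z) = (\<Prod>m=1..Suc N. of_nat m + z)" for z
      unfolding P_def pochhammer_prod
      by (rule prod.reindex_bij_witness[of _ "\<lambda>m. m - 1" Suc]) (auto simp: algebra_simps)
    from this this[of "- z" for z]
    have "P (1 + z) = (\<Prod>m=1..Suc N. of_nat m + z)" "P (1 - z) = (\<Prod>m=1..Suc N. of_nat m - z)" for z
      by simp_all
    ultimately have "?L = (\<Prod>m=1..Suc N. ((of_nat m - s) * (of_nat m - t) * (of_nat m - u)) /
        ((of_nat m + s) * (of_nat m + t) * (of_nat m + u)))"
      by (simp only: prod.distrib prod_dividef)
    also have "\<dots> = (\<Prod>m=1..Suc N. (of_nat m ^ 2 + T / of_nat m - S) / (of_nat m ^ 2 - T / of_nat m - S))"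
      by (intro prod.cong refl, subst minus plus, simp, subst plus) auto
    finally show ?thesis .
  qed
  with lim have "(\<lambda>N. \<Prod>m=1..Suc N. (of_nat m ^ 2 + T / of_nat m - S) / (of_nat m ^ 2 - T / of_nat m - S))
      \<longlonglongrightarrow> virasoro s t u"
    by simp
  moreover have "virasoro s t u = virasoro_tilde S T"
    by (subst stu(2), subst stu(3)) (rule virasoro_tilde_eq[OF stu(1), symmetric])
  ultimately show ?thesis
    by (subst filterlim_sequentially_Suc[symmetric]) simp
qed

lemma virasoro_tilde_eq_sum_poles:
  assumes "norm S \<le> 1 / 4" "norm T \<le> 1 / 4"
  shows "virasoro_tilde S T = 1 + (\<Sum>n. pole_term S T n)"
  using LIMSEQ_unique virasoro_tilde_tendsto[OF assms] cubic_prod_tendsto[OF assms] by blast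

section \<open>Exchange of sums and termwise differentiation\<close>

lemma suminf_swap:
  fixes f :: "nat \<Rightarrow> nat \<Rightarrow> 'a :: banach"
  assumes A: "summable A" "\<And>n. 0 \<le> A n" and B: "summable B" "\<And>n. 0 \<le> B n"
    and f: "\<And>m n. norm (f m n) \<le> A m * B n"
  shows "(\<Sum>m. \<Sum>n. f m n) = (\<Sum>n. \<Sum>m. f m n)"
proof -
  \<comment> \<open>Absolute convergence allows \<open>suminf\<close> to be traded for the unordered
    sum \<open>infsum\<close>, where the exchange is Fubini's theorem.\<close>
  have infsum_eq: "infsum g UNIV = suminf g" if "\<And>n. norm (g n) \<le> C n" "summable C"
    for g :: "nat \<Rightarrow> 'a" and C
  proof (rule infsumI, rule norm_summable_imp_has_sum)
    show *: "summable (\<lambda>n. norm (g n))"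
      by (rule summable_comparison_test'[of C 0]) (use that in auto)
    show "g sums suminf g"
      by (rule summable_sums[OF summable_norm_cancel[OF *]])
  qed
  have B': "(B has_sum suminf B) UNIV" and A': "(A has_sum suminf A) UNIV"
    using A B by (auto intro!: sums_nonneg_imp_has_sum summable_sums)
  have sumA: "norm (\<Sum>m. f m n) \<le> B n * suminf A" and sumB: "norm (\<Sum>n. f m n) \<le> A m * suminf B" for m n
  proof -
    have *: "summable (\<lambda>m. A m * B n)" "summable (\<lambda>n. A m * B n)"
      using A B by (auto intro: summable_mult summable_mult2)
    then have "norm (\<Sum>m. f m n) \<le> (\<Sum>m. A m * B n)" "norm (\<Sum>n. f m n) \<le> (\<Sum>n. A m * B n)"
      using f by (auto intro!: norm_suminf_le)
    then show "norm (\<Sum>m. f m n) \<le> B n * suminf A" "norm (\<Sum>n. f m n) \<le> A m * suminf B"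
      using A B by (simp_all add: suminf_mult2[symmetric] suminf_mult mult.commute)
  qed
  have "(\<lambda>(m, n). A m * B n) summable_on UNIV \<times> UNIV"
  proof (rule summable_on_SigmaI)
    show "((\<lambda>n. case (m, n) of (m, n) \<Rightarrow> A m * B n) has_sum A m * suminf B) UNIV" for m
      using has_sum_cmult_right[OF B', of "A m"] by simp
    show "(\<lambda>m. A m * suminf B) summable_on UNIV"
      using has_sum_cmult_left[OF A', of "suminf B"] by (auto simp: summable_on_def)
  qed (use A B in auto)
  then have "(\<lambda>x. norm (case x of (m, n) \<Rightarrow> f m n)) summable_on UNIV \<times> UNIV"
    by (rule Infinite_Sum.abs_summable_on_comparison_test') (use f in auto)
  then have "(\<lambda>(m, n). f m n) summable_on UNIV \<times> UNIV"
    by (rule abs_summable_summable)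
  then have "(\<Sum>\<^sub>\<infinity>m. \<Sum>\<^sub>\<infinity>n. f m n) = (\<Sum>\<^sub>\<infinity>n. \<Sum>\<^sub>\<infinity>m. f m n)"
    by (rule infsum_swap_banach)
  moreover have "(\<Sum>\<^sub>\<infinity>m. f m n) = (\<Sum>m. f m n)" "(\<Sum>\<^sub>\<infinity>n. f m n) = (\<Sum>n. f m n)" for m n
    by (rule infsum_eq[OF f summable_mult2[OF A(1)]], rule infsum_eq[OF f summable_mult[OF B(1)]])
  moreover have "(\<Sum>\<^sub>\<infinity>m. \<Sum>n. f m n) = (\<Sum>m. \<Sum>n. f m n)"
    by (rule infsum_eq[OF sumB summable_mult2[OF A(1)]])
  moreover have "(\<Sum>\<^sub>\<infinity>n. \<Sum>m. f m n) = (\<Sum>n. \<Sum>m. f m n)"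
    by (rule infsum_eq[OF sumA summable_mult2[OF B(1)]])
  ultimately show ?thesis
    by simp
qed

lemma higher_deriv_sum:
  fixes z :: complex
  assumes "open A" "z \<in> A" "\<And>i. i \<in> I \<Longrightarrow> f i holomorphic_on A"
  shows "(deriv ^^ k) (\<lambda>w. \<Sum>i\<in>I. f i w) z = (\<Sum>i\<in>I. (deriv ^^ k) (f i) z)"
  using assms
proof (induction I rule: infinite_finite_induct)
  case (insert i I)
  then show ?case
    using higher_deriv_add[of "f i" A "\<lambda>w. \<Sum>i\<in>I. f i w" z k]
    by (auto intro: holomorphic_intros)
qed auto

text \<open>A majorant for the functions alone controls all derivatives, since uniform limits of
  holomorphic functions can be differentiated termwise.\<close>

lemma higher_deriv_suminf:
  fixes f :: "nat \<Rightarrow> complex \<Rightarrow> complex"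
  assumes A: "open A" and f: "\<And>n. f n holomorphic_on A"
    and M: "\<And>n w. w \<in> A \<Longrightarrow> norm (f n w) \<le> M n" "summable M"
  shows "(\<lambda>w. \<Sum>n. f n w) holomorphic_on A"
    and "z \<in> A \<Longrightarrow> (\<lambda>n. (deriv ^^ k) (f n) z) sums (deriv ^^ k) (\<lambda>w. \<Sum>n. f n w) z"
proof -
  have lim: "uniform_limit A (\<lambda>n w. \<Sum>i<n. f i w) (\<lambda>w. \<Sum>i. f i w) sequentially"
    using M by (rule Weierstrass_m_test)
  have hol: "(\<lambda>w. \<Sum>i<n. f i w) holomorphic_on A" for n
    by (intro holomorphic_intros f)
  show "(\<lambda>w. \<Sum>n. f n w) holomorphic_on A"
  proof (rule holomorphic_uniform_sequence[OF A hol])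
    fix x assume "x \<in> A"
    then obtain d where "d > 0" "cball x d \<subseteq> A"
      using A open_contains_cball by blast
    then show "\<exists>d>0. cball x d \<subseteq> A \<and>
        uniform_limit (cball x d) (\<lambda>n w. \<Sum>i<n. f i w) (\<lambda>w. \<Sum>n. f n w) sequentially"
      using uniform_limit_on_subset[OF lim] by blast
  qed
  assume z: "z \<in> A"
  have "(\<lambda>n. (deriv ^^ k) (\<lambda>w. \<Sum>i<n. f i w) z) \<longlonglongrightarrow> (deriv ^^ k) (\<lambda>w. \<Sum>n. f n w) z"
    by (rule higher_deriv_complex_uniform_limit[OF lim _ _ A z]) (auto intro: hol always_eventually)
  then show "(\<lambda>n. (deriv ^^ k) (f n) z) sums (deriv ^^ k) (\<lambda>w. \<Sum>n. f n w) z"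
    by (simp add: sums_def higher_deriv_sum[OF A z f])
qed

section \<open>Expansion in S and differentiation in T\<close>

text \<open>The coefficient of \<open>S\<^sup>p\<close> in \<open>pole_term S T n\<close>.\<close>

definition pole_coeff :: "nat \<Rightarrow> nat \<Rightarrow> complex \<Rightarrow> complex" where
  "pole_coeff p n T = T / of_nat n * (2 + T / of_nat n / of_nat n ^ 2) * res_poly n (T / of_nat n) /
     (of_nat n ^ (2 * p + 2) * (1 - T / of_nat n / of_nat n ^ 2) ^ (p + 1))"

lemma pole_denominator_ge:
  fixes T :: complex
  assumes "norm T \<le> 1 / 4"
  shows "norm (1 - T / of_nat n / of_nat n ^ 2) \<ge> 3 / 4"
proof -
  have "norm T / real (n ^ 3) \<le> 1 / 4"
  proof (cases "n = 0")
    case False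
    then have "norm T / real (n ^ 3) \<le> norm T / 1"
      by (intro divide_left_mono) (auto simp: one_le_power)
    with assms show ?thesis by linarith
  qed simp
  then have "norm (T / of_nat n / of_nat n ^ 2) \<le> 1 / 4"
    by (simp add: norm_divide norm_power norm_mult power2_eq_square power3_eq_cube mult_ac)
  then show ?thesis
    using norm_triangle_ineq2[of 1 "T / of_nat n / of_nat n ^ 2"] by simp
qed

text \<open>The growth 2^p comes from (3/4)^(p+1) \<ge> 2^-(p+1) in the denominator; against |S|^p
  \<le> 4^-p it leaves a convergent geometric series.\<close>

lemma norm_pole_coeff_le:
  fixes T :: complex
  assumes "norm T \<le> 1 / 4"
  shows "norm (pole_coeff p n T) \<le> 4 / real n ^ 2 * 2 ^ p"
proof (cases "n = 0")
  case False
  have "1 / 2 ^ (p + 1) * real n \<le> (3 / 4) ^ (p + 1) * real n ^ (2 * p + 2)"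
  proof (intro mult_mono)
    show "1 / 2 ^ (p + 1) \<le> (3 / 4 :: real) ^ (p + 1)"
      unfolding power_one_over[symmetric] by (rule power_mono) auto
    show "real n \<le> real n ^ (2 * p + 2)"
      using False by (intro self_le_power) auto
  qed auto
  also have "\<dots> \<le> norm (1 - T / of_nat n / of_nat n ^ 2) ^ (p + 1) * real n ^ (2 * p + 2)"
    using pole_denominator_ge[OF assms] by (intro mult_right_mono power_mono) auto
  finally have "norm (pole_coeff p n T) \<le> (2 / real n) / (1 / 2 ^ (p + 1) * real n)"
    unfolding pole_coeff_def norm_divide
    using norm_pole_numerator_le[OF assms, of n] False
    by (intro frac_le) (auto simp: norm_mult norm_power mult_ac norm_divide)
  also have "\<dots> = 4 / real n ^ 2 * 2 ^ p"
    by (simp add: power2_eq_square)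
  finally show ?thesis .
qed (simp add: pole_coeff_def)

text \<open>With y = T / n^3 the denominator is n^2 (1 - y) - S. Its geometric series in S is the
  origin of (1 - y)^-(p+1), the factor of \<open>C_gf\<close> that depends on p.\<close>

lemma pole_term_sums:
  assumes "norm S \<le> 1 / 4" "norm T \<le> 1 / 4"
  shows "(\<lambda>p. S ^ p * pole_coeff p n T) sums pole_term S T n"
proof (cases "n = 0")
  case False
  define d where "d = 1 - T / of_nat n / of_nat n ^ 2"
  define r where "r = S / (of_nat n ^ 2 * d)"
  define A where "A = T / of_nat n * (2 + T / of_nat n / of_nat n ^ 2) * res_poly n (T / of_nat n)"
  have d: "norm d \<ge> 3 / 4"
    unfolding d_def by (rule pole_denominator_ge) fact
  have "1 * (3 / 4) \<le> real n ^ 2 * norm d"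
    using False d by (intro mult_mono) (auto simp: one_le_power)
  then have "norm S / (real n ^ 2 * norm d) \<le> (1 / 4) / (3 / 4)"
    using assms by (intro frac_le) auto
  also have "\<dots> < 1"
    by simp
  finally have r: "norm r < 1"
    by (simp add: r_def norm_divide norm_mult norm_power)
  have "(\<lambda>p. A / (of_nat n ^ 2 * d) * r ^ p) sums (A / (of_nat n ^ 2 * d) * (1 / (1 - r)))"
    by (intro sums_mult geometric_sums r)
  also have "(\<lambda>p. A / (of_nat n ^ 2 * d) * r ^ p) = (\<lambda>p. S ^ p * pole_coeff p n T)"
    unfolding pole_coeff_def A_def[symmetric] d_def[symmetric] r_def
    by (simp add: power_divide power_mult_distrib power_add power_mult power2_eq_square mult_ac)
  also have "A / (of_nat n ^ 2 * d) * (1 / (1 - r)) = A / (of_nat n ^ 2 * d - S)"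
  proof -
    have "of_nat n ^ 2 * d \<noteq> 0"
      using False d by auto
    then have "of_nat n ^ 2 * d * (1 - r) = of_nat n ^ 2 * d - S"
      by (simp add: r_def right_diff_distrib)
    then show ?thesis
      by (metis divide_divide_eq_left times_divide_eq_right mult_1_right)
  qed
  also have "of_nat n ^ 2 * d - S = of_nat n ^ 2 - T / of_nat n - S"
    using False by (simp add: d_def right_diff_distrib)
  finally show ?thesis
    by (simp add: pole_term_def A_def)
qed (simp add: pole_term_def pole_coeff_def)

text \<open>As a function of T this is the coefficient of S^p in V(S,T) - 1, by
  \<open>virasoro_tilde_eq_power_series\<close>.\<close>

definition pole_sum :: "nat \<Rightarrow> complex \<Rightarrow> complex" where
  "pole_sum p T = (\<Sum>n. pole_coeff p n T)"

lemma summable_pole_bound: "summable (\<lambda>n. 4 / real n ^ 2)"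
  using summable_mult[OF inverse_power_summable[of 2, where 'a = real], of 4]
  by (simp add: divide_inverse)

lemma virasoro_tilde_eq_power_series:
  assumes "norm S < 1 / 4" "norm T \<le> 1 / 4"
  shows "virasoro_tilde S T = 1 + (\<Sum>p. S ^ p * pole_sum p T)"
proof -
  have S: "norm S \<le> 1 / 4"
    using assms by simp
  have coeff: "summable (\<lambda>n. pole_coeff p n T)" for p
    by (rule summable_comparison_test'[OF summable_mult2[OF summable_pole_bound]])
       (rule norm_pole_coeff_le[OF assms(2)])
  have "(\<Sum>n. \<Sum>p. S ^ p * pole_coeff p n T) = (\<Sum>p. \<Sum>n. S ^ p * pole_coeff p n T)"
  proof (rule suminf_swap[OF summable_pole_bound])
    show "summable (\<lambda>p. (1 / 2 :: real) ^ p)"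
      by (rule summable_geometric) simp
    fix n p
    have "norm S ^ p * norm (pole_coeff p n T) \<le> (1 / 4) ^ p * (4 / real n ^ 2 * 2 ^ p)"
      using S by (intro mult_mono power_mono norm_pole_coeff_le assms) auto
    also have "\<dots> = 4 / real n ^ 2 * ((1 / 4) * 2) ^ p"
      by (simp only: power_mult_distrib) simp
    finally show "norm (S ^ p * pole_coeff p n T) \<le> 4 / real n ^ 2 * (1 / 2) ^ p"
      by (simp add: norm_mult norm_power)
  qed auto
  moreover have "(\<Sum>p. S ^ p * pole_coeff p n T) = pole_term S T n" for n
    using pole_term_sums[OF S assms(2)] by (simp add: sums_iff)
  moreover have "(\<Sum>n. S ^ p * pole_coeff p n T) = S ^ p * pole_sum p T" for p
    unfolding pole_sum_def by (rule suminf_mult[OF coeff])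
  ultimately show ?thesis
    using virasoro_tilde_eq_sum_poles[OF S assms(2)] by simp
qed

lemma pole_coeff_holomorphic: "pole_coeff p n holomorphic_on ball 0 (1 / 4)"
proof -
  have "1 - T / of_nat n / of_nat n ^ 2 \<noteq> 0" if "T \<in> ball 0 (1 / 4)" for T :: complex
    using pole_denominator_ge[of T n] that by auto
  then show ?thesis
    unfolding pole_coeff_def[abs_def] res_poly_def
    by (cases "n = 0") (auto intro!: holomorphic_intros)
qed

lemma pole_sum_holomorphic: "pole_sum p holomorphic_on ball 0 (1 / 4)" (is ?thesis1)
  and higher_deriv_pole_sum:
    "(\<lambda>n. (deriv ^^ q) (pole_coeff p n) 0) sums (deriv ^^ q) (pole_sum p) 0" (is ?thesis2)
proof -
  have bound: "norm (pole_coeff p n T) \<le> 4 / real n ^ 2 * 2 ^ p" if "T \<in> ball 0 (1 / 4)" for n T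
    using that by (intro norm_pole_coeff_le) auto
  note * = higher_deriv_suminf[OF open_ball pole_coeff_holomorphic bound
      summable_mult2[OF summable_pole_bound]]
  show ?thesis1
    unfolding pole_sum_def[abs_def] by (rule *(1))
  show ?thesis2
    unfolding pole_sum_def[abs_def] by (rule *(2)) auto
qed

lemma norm_pole_sum_le:
  assumes "norm T \<le> 1 / 4"
  shows "norm (pole_sum p T) \<le> (\<Sum>n. 4 / real n ^ 2) * 2 ^ p"
  unfolding pole_sum_def suminf_mult2[OF summable_pole_bound]
  by (intro norm_suminf_le norm_pole_coeff_le summable_mult2 summable_pole_bound assms)

text \<open>For each small S the series over p is differentiated termwise in T. The result is a
  power series in S near 0, whose p-th coefficient the outer derivative extracts. The constant 1
  disappears because q \<ge> 1.\<close>

lemma e_coeff_eq_pole_sum: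
  assumes "q \<ge> 1"
  shows "e_coeff p q = (deriv ^^ q) (pole_sum p) 0 / fact q"
proof -
  have "(\<lambda>p. (deriv ^^ q) (pole_sum p) 0 * S ^ p) sums (deriv ^^ q) (\<lambda>T. virasoro_tilde S T) 0"
    if S: "norm S < 1 / 4" for S
  proof -
    have "(\<lambda>p. (deriv ^^ q) (\<lambda>T. S ^ p * pole_sum p T) 0) sums
        (deriv ^^ q) (\<lambda>T. \<Sum>p. S ^ p * pole_sum p T) 0"
    proof (rule higher_deriv_suminf)
      show "(\<lambda>T. S ^ p * pole_sum p T) holomorphic_on ball 0 (1 / 4)" for p
        by (intro holomorphic_intros pole_sum_holomorphic)
      show "summable (\<lambda>p. (\<Sum>n. 4 / real n ^ 2) * (1 / 2 :: real) ^ p)"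
        by (intro summable_mult summable_geometric) simp
      show "norm (S ^ p * pole_sum p T) \<le> (\<Sum>n. 4 / real n ^ 2) * (1 / 2) ^ p"
        if "T \<in> ball 0 (1 / 4)" for p T
      proof -
        have "norm S ^ p * norm (pole_sum p T) \<le> (1 / 4) ^ p * ((\<Sum>n. 4 / real n ^ 2) * 2 ^ p)"
          using S that by (intro mult_mono power_mono norm_pole_sum_le) auto
        also have "\<dots> = (\<Sum>n. 4 / real n ^ 2) * ((1 / 4) * 2) ^ p"
          by (simp only: power_mult_distrib) simp
        finally show ?thesis
          by (simp add: norm_mult norm_power)
      qed
    qed auto
    also have "(\<lambda>p. (deriv ^^ q) (\<lambda>T. S ^ p * pole_sum p T) 0) =
        (\<lambda>p. (deriv ^^ q) (pole_sum p) 0 * S ^ p)"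
      by (subst higher_deriv_cmult[OF pole_sum_holomorphic]) (auto simp: mult.commute)
    also have "(deriv ^^ q) (\<lambda>T. \<Sum>p. S ^ p * pole_sum p T) 0 =
        (deriv ^^ q) (\<lambda>T. virasoro_tilde S T - 1) 0"
    proof (rule higher_deriv_cong_ev)
      have "\<forall>\<^sub>F T in nhds 0. T \<in> ball 0 (1 / 4 :: real)"
        by (rule eventually_nhds_in_open) auto
      then show "\<forall>\<^sub>F T in nhds 0. (\<Sum>p. S ^ p * pole_sum p T) = virasoro_tilde S T - 1"
        by eventually_elim (use virasoro_tilde_eq_power_series[OF S] in auto)
    qed simp
    also have "\<dots> = (deriv ^^ q) (\<lambda>T. virasoro_tilde S T) 0"
    proof -
      \<comment> \<open>Stated for arbitrary functions, so that the two values of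
        \<open>deriv\<close> agree at every point, whether the functions are differentiable there or
        not.\<close>
      have "((\<lambda>T. f T - 1) has_field_derivative D) (at z) \<longleftrightarrow> (f has_field_derivative D) (at z)"
        for f :: "complex \<Rightarrow> complex" and D z
        using DERIV_add[of f D z UNIV "\<lambda>_. -1" 0] DERIV_add[of "\<lambda>T. f T - 1" D z UNIV "\<lambda>_. 1" 0]
        by auto
      then have "deriv (\<lambda>T. virasoro_tilde S T - 1) = deriv (\<lambda>T. virasoro_tilde S T)"
        by (intro ext) (simp add: deriv_def)
      then show ?thesis
        using assms by (cases q) (simp_all add: funpow_Suc_right del: funpow.simps)
    qed
    finally show ?thesis .
  qed
  then have "\<forall>\<^sub>F S in nhds 0. (\<lambda>p. fps_nth (Abs_fps (\<lambda>p. (deriv ^^ q) (pole_sum p) 0)) p * S ^ p) sums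
      (deriv ^^ q) (\<lambda>T. virasoro_tilde S T) 0"
    using eventually_nhds_in_open[of "ball 0 (1 / 4)" "0 :: complex"]
    by (auto elim!: eventually_mono)
  then have "(\<lambda>S. (deriv ^^ q) (\<lambda>T. virasoro_tilde S T) 0) has_fps_expansion
      Abs_fps (\<lambda>p. (deriv ^^ q) (pole_sum p) 0)"
    by (rule has_fps_expansionI)
  from fps_nth_fps_expansion[OF this, of p] show ?thesis
    by (simp add: e_coeff_def)
qed

section \<open>Coefficients of T^q as a series over n\<close>

definition pole_fps :: "nat \<Rightarrow> nat \<Rightarrow> 'a :: field_char_0 fps" where
  "pole_fps p n = (2 + fps_X) * (\<Prod>m=1..<n. 1 - fps_const (of_nat n ^ 2 / (of_nat m * of_nat (n - m))) * fps_X) *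
     inverse ((1 - fps_X) ^ (p + 1))"

text \<open>Under T = n^3 y, \<open>pole_coeff p n\<close> becomes n^(-2p) y times the function of y
  with expansion \<open>pole_fps p n\<close>. The q-fold derivative in T adds n^(-3q), whence the
  weight 2p + 3q; the factor y accounts for the index q - 1.\<close>

lemma higher_deriv_pole_coeff:
  assumes "n \<ge> 1" "q \<ge> 1"
  shows "(deriv ^^ q) (pole_coeff p n) 0 / fact q = fps_nth (pole_fps p n) (q - 1) / of_nat n ^ (2 * p + 3 * q)"
proof -
  define h where "h y = y * ((2 + y) *
      (\<Prod>m=1..<n. 1 - of_nat n ^ 2 / (of_nat m * of_nat (n - m)) * y) * inverse ((1 - y) ^ (p + 1)))"
    for y :: complex
  have h: "h has_fps_expansion fps_X * pole_fps p n"
    unfolding h_def pole_fps_def by (intro fps_expansion_intros) auto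
  have hol: "h holomorphic_on ball 0 1"
    unfolding h_def by (auto intro!: holomorphic_intros)
  have n1: "norm (1 / of_nat n ^ 3 * w) < 1" if "norm w < 1" for w :: complex
  proof -
    have "norm w / real n ^ 3 \<le> norm w / 1"
      using assms by (intro divide_left_mono) (auto simp: one_le_power)
    with that show ?thesis
      by (simp add: norm_divide norm_power)
  qed
  have "pole_coeff p n = (\<lambda>T. 1 / of_nat n ^ (2 * p) * h (1 / of_nat n ^ 3 * T))"
  proof
    fix T :: complex
    define y where "y = 1 / of_nat n ^ 3 * T"
    have T: "T = y * of_nat n ^ 3"
      using assms by (simp add: y_def)
    have c: "T / of_nat n = y * of_nat n ^ 2"
      using assms by (simp add: T power2_eq_square power3_eq_cube)
    define P where "P = (\<Prod>m=1..<n. 1 - of_nat n ^ 2 / (of_nat m * of_nat (n - m)) * y)"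
    have P: "res_poly n (T / of_nat n) = P"
      unfolding c res_poly_def P_def by (simp add: mult.commute)
    have y: "T / of_nat n / of_nat n ^ 2 = y"
      using assms by (simp add: c)
    have "pole_coeff p n T = (of_nat n ^ 2 * (y * (2 + y) * P)) /
        (of_nat n ^ 2 * (of_nat n ^ (2 * p) * (1 - y) ^ (p + 1)))"
      unfolding pole_coeff_def P y unfolding c by (simp add: power_add mult_ac power2_eq_square)
    also have "\<dots> = (y * (2 + y) * P) / (of_nat n ^ (2 * p) * (1 - y) ^ (p + 1))"
      using assms by (subst mult_divide_mult_cancel_left) auto
    also have "\<dots> = 1 / of_nat n ^ (2 * p) * h y"
      unfolding h_def P_def[symmetric] by (simp add: divide_inverse mult_ac)
    finally show "pole_coeff p n T = 1 / of_nat n ^ (2 * p) * h y" .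
  qed
  then have "(deriv ^^ q) (pole_coeff p n) 0 =
      (deriv ^^ q) (\<lambda>T. 1 / of_nat n ^ (2 * p) * h (1 / of_nat n ^ 3 * T)) 0"
    by simp
  also have "\<dots> = 1 / of_nat n ^ (2 * p) * (deriv ^^ q) (\<lambda>T. h (1 / of_nat n ^ 3 * T)) 0"
  proof -
    have "(\<lambda>T. h (1 / of_nat n ^ 3 * T)) holomorphic_on ball 0 1"
      using n1 by (intro holomorphic_on_compose_gen[OF _ hol, unfolded o_def] holomorphic_intros) auto
    then show ?thesis
      by (rule higher_deriv_cmult) auto
  qed
  also have "(deriv ^^ q) (\<lambda>T. h (1 / of_nat n ^ 3 * T)) 0 = (1 / of_nat n ^ 3) ^ q * (deriv ^^ q) h 0"
  proof -
    show ?thesis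
      using higher_deriv_compose_linear[OF hol, of "ball 0 1" 0 "1 / of_nat n ^ 3" q] n1 by simp
  qed
  finally have "(deriv ^^ q) (pole_coeff p n) 0 / fact q =
      1 / of_nat n ^ (2 * p) * ((1 / of_nat n ^ 3) ^ q * fps_nth (fps_X * pole_fps p n) q)"
    unfolding fps_nth_fps_expansion[OF h] by simp
  also have "fps_nth (fps_X * pole_fps p n) q = (fps_nth (pole_fps p n) (q - 1) :: complex)"
    using assms by (cases q) auto
  finally show ?thesis
    by (simp add: power_divide power_add power_mult)
qed

lemma e_coeff_sums:
  assumes "q \<ge> 1"
  shows "(\<lambda>n. fps_nth (pole_fps p n) (q - 1) / of_nat n ^ (2 * p + 3 * q)) sums e_coeff p q"
proof -
  have "(\<lambda>n. (deriv ^^ q) (pole_coeff p n) 0 / fact q) sums e_coeff p q"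
    unfolding e_coeff_eq_pole_sum[OF assms] by (intro sums_divide higher_deriv_pole_sum)
  moreover have "(deriv ^^ q) (pole_coeff p n) 0 / fact q =
      fps_nth (pole_fps p n) (q - 1) / of_nat n ^ (2 * p + 3 * q)" for n
  \<comment> \<open>At n = 0 both sides vanish by the convention x / 0 = 0.\<close>
  proof (cases "n = 0")
    case True
    then have "pole_coeff p n = (\<lambda>_. 0)"
      by (simp add: pole_coeff_def fun_eq_iff)
    then show ?thesis
      using True assms by simp
  qed (use higher_deriv_pole_coeff assms in auto)
  ultimately show ?thesis
    by simp
qed

section \<open>Truncated multiple zeta values\<close>

text \<open>Arguments are listed from the largest summation index downwards.\<close>

primrec trunc_mzv :: "nat list \<Rightarrow> nat \<Rightarrow> real" where
  "trunc_mzv [] n = 1"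
| "trunc_mzv (k # ks) n = (\<Sum>m=1..<n. trunc_mzv ks m / real m ^ k)"

definition index_lists :: "nat \<Rightarrow> nat \<Rightarrow> nat list set" where
  "index_lists l n = {ns. length ns = l \<and> sorted_wrt (<) ns \<and> (\<forall>m\<in>set ns. 0 < m \<and> m < n)}"

lemma finite_index_lists: "finite (index_lists l n)"
proof (rule finite_subset)
  show "index_lists l n \<subseteq> {ns. set ns \<subseteq> {..<n} \<and> length ns = l}"
    by (auto simp: index_lists_def)
qed (rule finite_lists_length_eq, simp)

text \<open>The list is cut at its last, largest entry, which becomes the bound for the rest. This
  matches the recursion of \<open>trunc_mzv\<close>, whose head argument belongs to the largest
  index.\<close>

lemma index_lists_Suc:
  "index_lists (Suc l) n = (\<lambda>(m, ns). ns @ [m]) ` (SIGMA m:{1..<n}. index_lists l m)"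
proof (intro equalityI subsetI)
  fix ns assume ns: "ns \<in> index_lists (Suc l) n"
  then have "ns \<noteq> []"
    by (auto simp: index_lists_def)
  then have eq: "ns = butlast ns @ [last ns]"
    by simp
  from ns have "sorted_wrt (<) (butlast ns @ [last ns])" "\<forall>m\<in>set (butlast ns @ [last ns]). 0 < m \<and> m < n"
    "length ns = Suc l"
    using eq by (auto simp: index_lists_def)
  then have "(last ns, butlast ns) \<in> (SIGMA m:{1..<n}. index_lists l m)"
    by (auto simp: index_lists_def sorted_wrt_append)
  then show "ns \<in> (\<lambda>(m, ns). ns @ [m]) ` (SIGMA m:{1..<n}. index_lists l m)"
    by (rule rev_image_eqI) (use eq in simp)
qed (auto simp: index_lists_def sorted_wrt_append, use less_trans in blast)

lemma inj_snoc: "inj_on (\<lambda>(m, ns). ns @ [m]) A"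
  by (auto simp: inj_on_def)

lemma trunc_mzv_eq_sum:
  "trunc_mzv ks n = (\<Sum>ns\<in>index_lists (length ks) n. \<Prod>i<length ks. 1 / real (ns ! i) ^ (rev ks ! i))"
proof (induction ks arbitrary: n)
  case Nil
  have "index_lists 0 n = {[]}"
    by (auto simp: index_lists_def)
  then show ?case by simp
next
  case (Cons k ks)
  have "(\<Sum>ns\<in>index_lists (length (k # ks)) n. \<Prod>i<length (k # ks). 1 / real (ns ! i) ^ (rev (k # ks) ! i)) =
    (\<Sum>(m, ns)\<in>(SIGMA m:{1..<n}. index_lists (length ks) m).
        \<Prod>i<Suc (length ks). 1 / real ((ns @ [m]) ! i) ^ (rev (k # ks) ! i))"
    by (simp only: length_Cons index_lists_Suc)
       (subst sum.reindex[OF inj_snoc], simp only: o_def case_prod_unfold)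
  also have "\<dots> = (\<Sum>(m, ns)\<in>(SIGMA m:{1..<n}. index_lists (length ks) m).
        (\<Prod>i<length ks. 1 / real (ns ! i) ^ (rev ks ! i)) / real m ^ k)"
    by (intro sum.cong refl) (auto simp: index_lists_def nth_append)
  also have "\<dots> = (\<Sum>m=1..<n. \<Sum>ns\<in>index_lists (length ks) m.
        (\<Prod>i<length ks. 1 / real (ns ! i) ^ (rev ks ! i)) / real m ^ k)"
    by (subst sum.Sigma) (auto intro: finite_index_lists)
  also have "\<dots> = trunc_mzv (k # ks) n"
    by (simp add: Cons.IH sum_divide_distrib)
  finally show ?case ..
qed

lemma trunc_mzv_nonneg: "trunc_mzv ks n \<ge> 0"
  by (induction ks arbitrary: n) (auto intro!: sum_nonneg divide_nonneg_nonneg)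

lemma trunc_mzv_le:
  assumes "0 \<notin> set ks" "n \<ge> 1"
  shows "trunc_mzv ks n \<le> (1 + ln (real n)) ^ length ks"
  using assms
proof (induction ks arbitrary: n)
  case (Cons k ks)
  have "trunc_mzv (k # ks) n \<le> (\<Sum>m=1..<n. (1 + ln (real n)) ^ length ks * (1 / real m))"
    unfolding trunc_mzv.simps
  proof (rule sum_mono)
    fix m assume m: "m \<in> {1..<n}"
    have "trunc_mzv ks m * (1 / real m ^ k) \<le> (1 + ln (real n)) ^ length ks * (1 / real m)"
    proof (intro mult_mono)
      have "trunc_mzv ks m \<le> (1 + ln (real m)) ^ length ks"
        using Cons m by auto
      also have "\<dots> \<le> (1 + ln (real n)) ^ length ks"
        using m by (intro power_mono) auto
      finally show "trunc_mzv ks m \<le> (1 + ln (real n)) ^ length ks" .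
      show "1 / real m ^ k \<le> 1 / real m"
        using m Cons.prems by (intro divide_left_mono self_le_power) auto
    qed (use Cons.prems in auto)
    then show "trunc_mzv ks m / real m ^ k \<le> (1 + ln (real n)) ^ length ks * (1 / real m)"
      by simp
  qed
  also have "\<dots> = (1 + ln (real n)) ^ length ks * (\<Sum>m=1..<n. 1 / real m)"
    by (simp only: sum_distrib_left)
  also have "\<dots> \<le> (1 + ln (real n)) ^ length ks * (1 + ln (real n))"
  proof (intro mult_left_mono)
    have "(\<Sum>m=1..<n. 1 / real m) = (\<Sum>m=1..<n. inverse (real m))"
      by (simp add: divide_inverse)
    also have "\<dots> \<le> harm n"
      unfolding harm_def by (intro sum_mono2) auto
    \<comment> \<open>The sequence \<open>harm n\<close> - ln n decreases from its value 1 at n =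
      1.\<close>
    also have "\<dots> \<le> 1 + ln (real n)"
      using euler_mascheroni_sequence_decreasing[of 1 n] Cons.prems by (simp add: harm_def)
    finally show "(\<Sum>m=1..<n. 1 / real m) \<le> 1 + ln (real n)" .
  qed (use Cons.prems in auto)
  finally show ?case by (simp add: mult.commute)
qed auto

text \<open>The truncated values grow only like powers of ln n; passing from the exponent 2 to 3/2
  absorbs them and still leaves a convergent series.\<close>

lemma summable_trunc_mzv:
  assumes "0 \<notin> set ks" "k \<ge> 2"
  shows "summable (\<lambda>n. trunc_mzv ks n / real n ^ k)"
proof (rule summable_comparison_test_bigo)
  show "summable (\<lambda>n. norm (real n powr (-3/2)))"
    by (simp add: summable_real_powr_iff)
  have "(\<lambda>n. trunc_mzv ks n / real n ^ k) \<in> O(\<lambda>n. (1 + ln (real n)) ^ length ks / real n ^ 2)"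
  proof (rule landau_o.big_mono, use eventually_ge_at_top[of 1] in eventually_elim)
    fix n :: nat assume n: "n \<ge> 1"
    have "trunc_mzv ks n / real n ^ k \<le> (1 + ln (real n)) ^ length ks / real n ^ 2"
      using n assms by (intro frac_le trunc_mzv_le power_increasing) auto
    then show "norm (trunc_mzv ks n / real n ^ k) \<le> norm ((1 + ln (real n)) ^ length ks / real n ^ 2)"
      using n by (simp add: trunc_mzv_nonneg)
  qed
  also have "(\<lambda>n. (1 + ln (real n)) ^ length ks / real n ^ 2) \<in> O(\<lambda>n. real n powr (-3/2))"
    by real_asymp
  finally show "(\<lambda>n. trunc_mzv ks n / real n ^ k) \<in> O(\<lambda>n. real n powr (-3/2))" .
qed

text \<open>The term with \<open>n = 0\<close> vanishes because \<open>x / 0 = 0\<close>.\<close>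

lemma mzv_sums:
  assumes "0 \<notin> set ks" "k \<ge> 2"
  shows "(\<lambda>n. trunc_mzv (rev ks) n / real n ^ k) sums mzv (ks @ [k])"
proof -
  define l where "l = length ks"
  define f where "f ns = (\<Prod>i<Suc l. 1 / real (ns ! i) ^ ((ks @ [k]) ! i))" for ns
  have dom: "{ns. length ns = length (ks @ [k]) \<and> sorted_wrt (<) ns \<and> (\<forall>n\<in>set ns. 0 < n)} =
      (\<lambda>(m, ns). ns @ [m]) ` (SIGMA m:{1..}. index_lists l m)" (is "?D = _")
  proof -
    have "?D = (\<Union>n. index_lists (Suc l) n)"
    proof (intro equalityI subsetI)
      fix ns assume ns: "ns \<in> ?D"
      then have "ns \<in> index_lists (Suc l) (Suc (Max (set ns)))"
        by (auto simp: index_lists_def l_def less_Suc_eq_le)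
      then show "ns \<in> (\<Union>n. index_lists (Suc l) n)"
        by blast
    qed (auto simp: index_lists_def l_def)
    also have "\<dots> = (\<lambda>(m, ns). ns @ [m]) ` (\<Union>n. SIGMA m:{1..<n}. index_lists l m)"
      by (simp only: index_lists_Suc image_UN)
    also have "(\<Union>n. SIGMA m:{1..<n}. index_lists l m) = (SIGMA m:{1..}. index_lists l m)"
      by (auto intro: lessI)
    finally show ?thesis .
  qed
  have f_snoc: "f (ns @ [m]) = (\<Prod>i<l. 1 / real (ns ! i) ^ (ks ! i)) / real m ^ k"
    if "ns \<in> index_lists l m" for m ns
    using that by (auto simp: f_def index_lists_def nth_append l_def)
  have f_nonneg: "f ns \<ge> 0" for ns
    unfolding f_def by (intro prod_nonneg) auto
  have inner: "((\<lambda>ns. f (ns @ [m])) has_sum (trunc_mzv (rev ks) m / real m ^ k)) (index_lists l m)" for m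
  proof -
    have "(\<Sum>ns\<in>index_lists l m. f (ns @ [m])) = trunc_mzv (rev ks) m / real m ^ k"
      by (simp add: f_snoc trunc_mzv_eq_sum sum_divide_distrib l_def)
    then show ?thesis
      using has_sum_finite[OF finite_index_lists] by metis
  qed
  have summable: "summable (\<lambda>n. trunc_mzv (rev ks) n / real n ^ k)"
    using assms by (intro summable_trunc_mzv) auto
  then have "((\<lambda>n. trunc_mzv (rev ks) n / real n ^ k) has_sum (\<Sum>n. trunc_mzv (rev ks) n / real n ^ k)) UNIV"
    by (intro sums_nonneg_imp_has_sum summable_sums) (auto simp: trunc_mzv_nonneg)
  then have outer: "((\<lambda>n. trunc_mzv (rev ks) n / real n ^ k) has_sum (\<Sum>n. trunc_mzv (rev ks) n / real n ^ k)) {1..}"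
    by (rule has_sum_cong_neutral[THEN iffD1, rotated -1]) (use assms in \<open>auto simp: not_le\<close>)
  have inner': "((\<lambda>ns. (case (m, ns) of (m, ns) \<Rightarrow> f (ns @ [m]))) has_sum (trunc_mzv (rev ks) m / real m ^ k))
      (index_lists l m)" for m
    using inner by simp
  have "((\<lambda>(m, ns). f (ns @ [m])) has_sum (\<Sum>n. trunc_mzv (rev ks) n / real n ^ k))
      (SIGMA m:{1..}. index_lists l m)"
  proof (rule has_sum_SigmaI[OF inner' outer])
    \<comment> \<open>As \<open>f\<close> is nonnegative, convergence of the iterated sums is enough
      for unordered summability.\<close>
    show "(\<lambda>(m, ns). f (ns @ [m])) summable_on (SIGMA m:{1..}. index_lists l m)"
      by (rule summable_on_SigmaI[OF inner'])
         (use outer f_nonneg in \<open>auto simp: summable_on_def\<close>)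
  qed
  then have "(f has_sum (\<Sum>n. trunc_mzv (rev ks) n / real n ^ k)) ?D"
    unfolding dom by (subst has_sum_reindex[OF inj_snoc]) (simp add: o_def case_prod_unfold)
  then have "mzv (ks @ [k]) = (\<Sum>n. trunc_mzv (rev ks) n / real n ^ k)"
    unfolding mzv_def f_def l_def by (simp add: infsumI)
  with summable show ?thesis
    by (simp add: sums_iff)
qed

section \<open>Generating function of the truncated sums Z\<close>

definition Z_trunc :: "nat \<Rightarrow> nat \<Rightarrow> real" where
  "Z_trunc r n = (\<Sum>rs\<in>{rs. set rs \<subseteq> {1, 2} \<and> sum_list rs = r}. 2 ^ count_list rs 1 * trunc_mzv rs n)"

lemma sum_Cons_one_two:
  fixes f :: "nat list \<Rightarrow> 'a :: comm_monoid_add"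
  shows "(\<Sum>rs\<in>{rs. set rs \<subseteq> {1, 2} \<and> sum_list rs = Suc (Suc r)}. f rs) =
     (\<Sum>rs\<in>{rs. set rs \<subseteq> {1, 2} \<and> sum_list rs = Suc r}. f (1 # rs)) +
     (\<Sum>rs\<in>{rs. set rs \<subseteq> {1, 2} \<and> sum_list rs = r}. f (2 # rs))"
proof -
  let ?A = "\<lambda>r. {rs :: nat list. set rs \<subseteq> {1, 2} \<and> sum_list rs = r}"
  have "?A (Suc (Suc r)) = (#) 1 ` ?A (Suc r) \<union> (#) 2 ` ?A r"
  proof (intro equalityI subsetI)
    fix rs assume "rs \<in> ?A (Suc (Suc r))"
    then show "rs \<in> (#) 1 ` ?A (Suc r) \<union> (#) 2 ` ?A r"
      by (cases rs) auto
  qed auto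
  moreover have "(\<Sum>rs\<in>(#) 1 ` ?A (Suc r) \<union> (#) 2 ` ?A r. f rs) =
      (\<Sum>rs\<in>(#) 1 ` ?A (Suc r). f rs) + (\<Sum>rs\<in>(#) 2 ` ?A r. f rs)"
    using finite_Z_indices by (intro sum.union_disjoint) auto
  ultimately show ?thesis
    by (simp add: sum.reindex)
qed

lemma index_set_0: "{rs :: nat list. set rs \<subseteq> {1, 2} \<and> sum_list rs = 0} = {[]}"
proof (intro equalityI subsetI)
  fix rs :: "nat list" assume "rs \<in> {rs. set rs \<subseteq> {1, 2} \<and> sum_list rs = 0}"
  then show "rs \<in> {[]}"
    by (cases rs) auto
qed auto

lemma index_set_1: "{rs :: nat list. set rs \<subseteq> {1, 2} \<and> sum_list rs = Suc 0} = {[1]}"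
proof (intro equalityI subsetI)
  fix rs :: "nat list" assume rs: "rs \<in> {rs. set rs \<subseteq> {1, 2} \<and> sum_list rs = Suc 0}"
  then obtain a as where "rs = a # as"
    by (cases rs) auto
  with rs have "a = 1" "as \<in> {rs. set rs \<subseteq> {1, 2} \<and> sum_list rs = 0}"
    by auto
  then show "rs \<in> {[1]}"
    unfolding index_set_0 using \<open>rs = a # as\<close> by simp
qed auto

lemma Z_trunc_0: "Z_trunc 0 n = 1"
  unfolding Z_trunc_def index_set_0 by simp

lemma Z_trunc_1: "Z_trunc (Suc 0) n = (\<Sum>m=1..<n. 2 / real m)"
  unfolding Z_trunc_def index_set_1 by (simp add: sum_distrib_left)

lemma Z_trunc_Suc_Suc:
  "Z_trunc (Suc (Suc r)) n = (\<Sum>m=1..<n. 2 * Z_trunc (Suc r) m / real m + Z_trunc r m / real m ^ 2)"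
proof -
  let ?A = "\<lambda>r. {rs :: nat list. set rs \<subseteq> {1, 2} \<and> sum_list rs = r}"
  have "(\<Sum>rs\<in>?A s. c * 2 ^ count_list rs 1 * (\<Sum>m=1..<n. trunc_mzv rs m / real m ^ k)) =
      (\<Sum>m=1..<n. c * Z_trunc s m / real m ^ k)" for c s k
    unfolding Z_trunc_def
    by (simp add: sum_distrib_left sum_divide_distrib sum.swap[of _ "{_..<_}"] mult.assoc)
  from this[where c = 2 and s = "Suc r" and k = 1] this[where c = 1 and s = r and k = 2] show ?thesis
    unfolding Z_trunc_def[of "Suc (Suc r)"] sum_Cons_one_two
    by (simp add: sum.distrib)
qed

lemma Z_trunc_one: "Z_trunc r (Suc 0) = (if r = 0 then 1 else 0)"
  by (cases r; cases "r - 1") (auto simp: Z_trunc_0 Z_trunc_1 Z_trunc_Suc_Suc)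

text \<open>In (1 + x / m)^2 = 1 + 2 x / m + x^2 / m^2 the three terms mean that m is absent,
  carries the argument 1 with weight 2, or carries the argument 2. This accounts for the entries 1
  and 2 and for the powers of 2 in \<open>Z_sum\<close>.\<close>

lemma Z_trunc_fps:
  assumes "n \<ge> 1"
  shows "Abs_fps (\<lambda>r. Z_trunc r n) = (\<Prod>m=1..<n. (1 + fps_const (1 / real m) * fps_X) ^ 2)"
  using assms
proof (induction n rule: dec_induct)
  case base
  show ?case
    by (auto simp: fps_eq_iff Z_trunc_one)
next
  case (step n)
  define a where "a = 1 / real n"
  have "Abs_fps (\<lambda>r. Z_trunc r (Suc n)) =
      Abs_fps (\<lambda>r. Z_trunc r n) * (1 + fps_const (2 * a) * fps_X + fps_const (a\<^sup>2) * fps_X\<^sup>2)"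
    (is "_ = ?F * _")
  proof (rule fps_ext)
    fix r
    have expand: "?F * (1 + fps_const (2 * a) * fps_X + fps_const (a\<^sup>2) * fps_X\<^sup>2) =
        ?F + fps_const (2 * a) * (?F * fps_X) + fps_const (a\<^sup>2) * (?F * fps_X\<^sup>2)"
      by (simp only: distrib_left mult_1_right mult.left_commute)
    consider "r = 0" | "r = Suc 0" | s where "r = Suc (Suc s)"
      by (metis not0_implies_Suc)
    then show "fps_nth (Abs_fps (\<lambda>r. Z_trunc r (Suc n))) r =
        fps_nth (Abs_fps (\<lambda>r. Z_trunc r n) * (1 + fps_const (2 * a) * fps_X + fps_const (a\<^sup>2) * fps_X\<^sup>2)) r"
      unfolding expand using step.hyps(1)
      by cases (simp_all add: Z_trunc_0 Z_trunc_1 Z_trunc_Suc_Suc fps_X_power_mult_right_nth a_def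
          power_divide del: fps_const_mult fps_const_power)
  qed
  also have "1 + fps_const (2 * a) * fps_X + fps_const (a\<^sup>2) * fps_X\<^sup>2 = (1 + fps_const a * fps_X) ^ 2"
    by (simp add: power2_eq_square algebra_simps flip: fps_const_mult)
  finally show ?case
    using step by (simp add: a_def)
qed

text \<open>\<open>trunc_mzv\<close> reads its arguments from the largest index down, so the lists
  appear reversed; reversal permutes the index set and preserves the number of ones.\<close>

lemma Z_sum_sums:
  assumes "k \<ge> 2"
  shows "(\<lambda>n. Z_trunc r n / real n ^ k) sums Z_sum k r"
proof -
  let ?A = "{rs :: nat list. set rs \<subseteq> {1, 2} \<and> sum_list rs = r}"
  have "(\<lambda>n. \<Sum>rs\<in>?A. 2 ^ count_list rs 1 * (trunc_mzv (rev rs) n / real n ^ k)) sums Z_sum k r"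
    unfolding Z_sum_def by (intro sums_sum sums_mult mzv_sums assms) auto
  moreover have "(\<Sum>rs\<in>?A. 2 ^ count_list rs 1 * (trunc_mzv (rev rs) n / real n ^ k)) =
      Z_trunc r n / real n ^ k" for n
    unfolding Z_trunc_def sum_divide_distrib
    by (rule sum.reindex_bij_witness[of _ rev rev]) auto
  ultimately show ?thesis by simp
qed

section \<open>The generating function\<close>

text \<open>This is x(y) = y + y^2 + 2 y^3 + 5 y^4 + ..., the root of x - x^2 = y without constant
  term.\<close>

definition catalan_fps :: "real fps" where
  "catalan_fps = (1 - sqrt_1_minus_4y) / 2"

lemma catalan_fps_nth_0: "fps_nth catalan_fps 0 = 0"
  by (simp add: catalan_fps_def sqrt_1_minus_4y(2) fps_divide_unit)

lemma catalan_fps_eq: "catalan_fps - catalan_fps\<^sup>2 = fps_X"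
proof -
  have "2 * catalan_fps = 1 - sqrt_1_minus_4y"
    by (simp add: catalan_fps_def fps_divide_unit mult.commute[of 2] mult.assoc inverse_mult_eq_1)
  then have "sqrt_1_minus_4y = 1 - 2 * catalan_fps"
    by simp
  then have "(1 - 2 * catalan_fps)\<^sup>2 = 1 - 4 * fps_X"
    using sqrt_1_minus_4y(1) by simp
  then have "fps_const 4 * (catalan_fps - catalan_fps\<^sup>2) = fps_const 4 * fps_X"
    by (simp add: power2_eq_square algebra_simps flip: numeral_fps_const)
  then show ?thesis
    by (subst (asm) mult_left_cancel) auto
qed

section \<open>Integrality of the coefficients C\<close>

definition Ints_fps :: "real fps \<Rightarrow> bool" where
  "Ints_fps f \<longleftrightarrow> (\<forall>n. fps_nth f n \<in> \<int>)"

lemma Ints_fps_mult: "Ints_fps f \<Longrightarrow> Ints_fps g \<Longrightarrow> Ints_fps (f * g)"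
  by (auto simp: Ints_fps_def fps_mult_nth intro!: Ints_sum Ints_mult)

lemma Ints_fps_power: "Ints_fps f \<Longrightarrow> Ints_fps (f ^ k)"
proof (induction k)
  case 0
  show ?case by (auto simp: Ints_fps_def)
qed (simp add: Ints_fps_mult)

text \<open>The closed form hides integrality behind a division by 2, but x = y + x^2 expresses each
  coefficient through earlier ones by sums and products: x(0) = 0 removes the end terms of the
  convolution.\<close>

lemma Ints_catalan_fps: "Ints_fps catalan_fps"
proof -
  have "fps_nth catalan_fps n \<in> \<int>" for n
  proof (induction n rule: less_induct)
    case (less n)
    have "fps_nth catalan_fps n = fps_nth (fps_X + catalan_fps * catalan_fps) n"
      using catalan_fps_eq by (simp add: power2_eq_square algebra_simps)
    also have "\<dots> = fps_nth fps_X n + (\<Sum>i=0..n. fps_nth catalan_fps i * fps_nth catalan_fps (n - i))"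
      by (simp add: fps_mult_nth)
    also have "\<dots> \<in> \<int>"
    proof (intro Ints_add Ints_sum)
      fix i assume i: "i \<in> {0..n}"
      show "fps_nth catalan_fps i * fps_nth catalan_fps (n - i) \<in> \<int>"
      proof (cases "i = 0 \<or> i = n")
        case False
        with i show ?thesis
          by (intro Ints_mult less) auto
      qed (auto simp: catalan_fps_nth_0)
    qed (auto simp: fps_X_def)
    finally show ?case .
  qed
  then show ?thesis
    by (simp add: Ints_fps_def)
qed

lemma C_gf_eq_catalan:
  "C_gf (int p) r = (2 + fps_X) * inverse ((1 - fps_X) ^ (p + 1)) * catalan_fps ^ r"
proof -
  have "int p + 1 = int (p + 1)" by simp
  then have "(1 - fps_X :: real fps) powi (int p + 1) = (1 - fps_X) ^ (p + 1)"
    by (simp only: power_int_of_nat)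
  moreover have "fps_nth ((1 - fps_X :: real fps) ^ (p + 1)) 0 \<noteq> 0"
    by (simp add: fps_power_zeroth)
  ultimately show ?thesis
    by (simp only: C_gf_def catalan_fps_def fps_divide_unit not_False_eq_True)
qed

lemma C_coeff_Ints: "C_coeff (int p) q r \<in> \<int>"
proof -
  have "Ints_fps (inverse (1 - fps_X))"
    by (simp add: Ints_fps_def flip: fps_inverse_gp'[unfolded])
  then have "Ints_fps (C_gf (int p) r)"
    unfolding C_gf_eq_catalan fps_inverse_power
    by (intro Ints_fps_mult Ints_fps_power Ints_catalan_fps) (auto simp: Ints_fps_def numeral_fps_const fps_X_def)
  then show ?thesis
    by (simp add: C_coeff_def Ints_fps_def)
qed

section \<open>The substitution y = x (1 - x)\<close>

lemma catalan_prod: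
  assumes "n \<ge> 1"
  shows "(\<Prod>m=1..<n. (1 - fps_const (real n / real m) * catalan_fps) ^ 2) =
    (\<Prod>m=1..<n. 1 - fps_const (real n ^ 2 / (real m * real (n - m))) * fps_X)"
proof -
  let ?f = "\<lambda>m. 1 - fps_const (real n / real m) * catalan_fps"
  have "(\<Prod>m=1..<n. ?f m ^ 2) = (\<Prod>m=1..<n. ?f m) * (\<Prod>m=1..<n. ?f m)"
    by (simp add: power2_eq_square prod.distrib)
  also have "(\<Prod>m=1..<n. ?f m) * (\<Prod>m=1..<n. ?f m) = (\<Prod>m=1..<n. ?f m) * (\<Prod>m=1..<n. ?f (n - m))"
    by (rule arg_cong2[where f = "(*)", OF refl])
       (rule prod.reindex_bij_witness[of _ "\<lambda>m. n - m" "\<lambda>m. n - m"], auto)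
  also have "\<dots> = (\<Prod>m=1..<n. ?f m * ?f (n - m))"
    by (simp add: prod.distrib)
  also have "\<dots> = (\<Prod>m=1..<n. 1 - fps_const (real n ^ 2 / (real m * real (n - m))) * fps_X)"
  proof (rule prod.cong)
    fix m assume m: "m \<in> {1..<n}"
    define a b where "a = real n / real m" and "b = real n / real (n - m)"
    have "real n - real m > 0" "real m > 0"
      using m by auto
    \<comment> \<open>1 / a + 1 / b = m / n + (n - m) / n = 1, so (1 - a x) (1 - b x) involves x
      only through x - x^2 = y.\<close>
    then have ab: "a + b = a * b"
      using m by (simp add: a_def b_def of_nat_diff field_simps)
    have "?f m * ?f (n - m) = 1 - fps_const (a + b) * catalan_fps + fps_const (a * b) * catalan_fps\<^sup>2"
      unfolding a_def[symmetric] b_def[symmetric]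
      by (simp add: algebra_simps power2_eq_square flip: fps_const_add fps_const_mult)
    also have "\<dots> = 1 - fps_const (a * b) * (catalan_fps - catalan_fps\<^sup>2)"
      unfolding ab by (simp add: algebra_simps)
    also have "a * b = real n ^ 2 / (real m * real (n - m))"
      by (simp add: a_def b_def power2_eq_square)
    finally show "?f m * ?f (n - m) = 1 - fps_const (real n ^ 2 / (real m * real (n - m))) * fps_X"
      unfolding catalan_fps_eq .
  qed simp
  finally show ?thesis .
qed

lemma sum_C_coeff_Z_trunc:
  assumes "n \<ge> 1" "q \<ge> 1"
  shows "(\<Sum>r<q. (-1) ^ r * C_coeff (int p) q r * real n ^ r * Z_trunc r n) = fps_nth (pole_fps p n) (q - 1)"
proof -
  define A :: "real fps" where "A = (2 + fps_X) * inverse ((1 - fps_X) ^ (p + 1))"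
  define F where "F = (\<Prod>m=1..<n. (1 + fps_const (1 / real m) * fps_X) ^ 2)"
  \<comment> \<open>Substituting -n x(y) turns the factors (1 + x / m)^2 of \<open>F\<close> into (1
    - n x / m)^2.\<close>
  define c where "c = fps_const (- real n) * catalan_fps"
  have c0: "fps_nth c 0 = 0"
    by (simp add: c_def catalan_fps_nth_0)
  have "pole_fps p n = A * (\<Prod>m=1..<n. (1 - fps_const (real n / real m) * catalan_fps) ^ 2)"
    unfolding catalan_prod[OF assms(1)] by (simp add: pole_fps_def A_def mult_ac)
  also have "(\<Prod>m=1..<n. (1 - fps_const (real n / real m) * catalan_fps) ^ 2) = fps_compose F c"
    unfolding F_def
    by (simp add: fps_compose_prod_distrib[OF c0] fps_compose_power[OF c0, symmetric] fps_compose_add_distrib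
        fps_compose_mult_distrib[OF c0] c0)
       (simp add: c_def mult.assoc[symmetric] flip: fps_const_neg)
  finally have "fps_nth (pole_fps p n) (q - 1) = fps_nth (A * fps_compose F c) (q - 1)"
    by simp
  also have "\<dots> = (\<Sum>i=0..q-1. fps_nth A i * fps_nth (fps_compose F c) (q - 1 - i))"
    by (simp add: fps_mult_nth)
  also have "\<dots> = (\<Sum>i=0..q-1. \<Sum>r<q. fps_nth F r * (fps_nth A i * fps_nth (c ^ r) (q - 1 - i)))"
  proof (intro sum.cong refl)
    fix i assume i: "i \<in> {0..q-1}"
    have "fps_nth (fps_compose F c) (q - 1 - i) = (\<Sum>r=0..q-1-i. fps_nth F r * fps_nth (c ^ r) (q - 1 - i))"
      by (simp add: fps_compose_nth)
    \<comment> \<open>\<open>c\<close> has no constant term, so \<open>c ^ r\<close> starts in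
      degree r, and the range of r can be enlarged to one that does not depend on
      \<open>i\<close>.\<close>
    also have "\<dots> = (\<Sum>r<q. fps_nth F r * fps_nth (c ^ r) (q - 1 - i))"
      using assms startsby_zero_power_prefix[OF c0]
      by (intro sum.mono_neutral_left) (auto simp: not_le)
    finally show "fps_nth A i * fps_nth (fps_compose F c) (q - 1 - i) =
        (\<Sum>r<q. fps_nth F r * (fps_nth A i * fps_nth (c ^ r) (q - 1 - i)))"
      by (simp add: sum_distrib_left mult_ac)
  qed
  also have "\<dots> = (\<Sum>r<q. fps_nth F r * fps_nth (A * c ^ r) (q - 1))"
    by (subst sum.swap) (simp add: fps_mult_nth sum_distrib_left)
  also have "\<dots> = (\<Sum>r<q. (-1) ^ r * C_coeff (int p) q r * real n ^ r * Z_trunc r n)"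
  proof (intro sum.cong refl)
    fix r
    have "A * c ^ r = fps_const ((- real n) ^ r) * C_gf (int p) r"
      by (simp add: C_gf_eq_catalan A_def c_def power_mult_distrib fps_const_power mult_ac del: fps_const_neg)
    then have "fps_nth (A * c ^ r) (q - 1) = (-1) ^ r * real n ^ r * C_coeff (int p) q r"
      by (simp add: C_coeff_def power_minus[of "real n"])
    moreover have "fps_nth F r = Z_trunc r n"
      using Z_trunc_fps[OF assms(1)] by (simp add: F_def fps_eq_iff)
    ultimately show "fps_nth F r * fps_nth (A * c ^ r) (q - 1) =
        (-1) ^ r * C_coeff (int p) q r * real n ^ r * Z_trunc r n"
      by simp
  qed
  finally show ?thesis ..
qed

section \<open>Passage from real to complex power series\<close>

definition complex_fps :: "real fps \<Rightarrow> complex fps" where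
  "complex_fps f = Abs_fps (\<lambda>n. of_real (fps_nth f n))"

lemma complex_fps_mult: "complex_fps (f * g) = complex_fps f * complex_fps g"
  by (simp add: complex_fps_def fps_eq_iff fps_mult_nth)

lemma complex_fps_add: "complex_fps (f + g) = complex_fps f + complex_fps g"
  by (simp add: complex_fps_def fps_eq_iff)

lemma complex_fps_diff: "complex_fps (f - g) = complex_fps f - complex_fps g"
  by (simp add: complex_fps_def fps_eq_iff)

lemma complex_fps_const: "complex_fps (fps_const c) = fps_const (of_real c)"
  by (simp add: complex_fps_def fps_eq_iff)

lemma complex_fps_1: "complex_fps 1 = 1"
  by (simp add: complex_fps_def fps_eq_iff)

lemma complex_fps_X: "complex_fps fps_X = fps_X"
  by (simp add: complex_fps_def fps_eq_iff fps_X_def)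

lemma complex_fps_prod: "complex_fps (\<Prod>i\<in>I. f i) = (\<Prod>i\<in>I. complex_fps (f i))"
  by (induction I rule: infinite_finite_induct) (simp_all add: complex_fps_1 complex_fps_mult)

lemma complex_fps_power: "complex_fps (f ^ k) = complex_fps f ^ k"
  by (induction k) (simp_all add: complex_fps_1 complex_fps_mult)

lemma complex_fps_inverse:
  assumes "fps_nth f 0 \<noteq> 0"
  shows "complex_fps (inverse f) = inverse (complex_fps f)"
proof -
  have "complex_fps f * complex_fps (inverse f) = 1"
    using assms by (simp add: inverse_mult_eq_1' complex_fps_1 flip: complex_fps_mult)
  then show ?thesis
    using fps_inverse_unique by metis
qed

text \<open>The two occurrences of \<open>pole_fps\<close> differ in type: the left one is complex,
  as it arises from derivatives, the right one real, as it arises from multiple zeta values.\<close>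

lemma pole_fps_of_real: "pole_fps p n = complex_fps (pole_fps p n)"
proof -
  have "fps_nth ((1 - fps_X :: real fps) ^ (p + 1)) 0 \<noteq> 0"
    by (simp add: fps_power_zeroth)
  then show ?thesis
    unfolding pole_fps_def numeral_fps_const
    by (simp only: complex_fps_mult complex_fps_add complex_fps_diff complex_fps_const complex_fps_1
        complex_fps_X complex_fps_prod complex_fps_power complex_fps_inverse not_False_eq_True) simp
qed

section \<open>Summation over n and assembly\<close>

lemma Z_sum_combination_sums:
  assumes "q \<ge> 1"
  shows "(\<lambda>n. fps_nth (pole_fps p n) (q - 1) / real n ^ (2 * p + 3 * q)) sums
    (\<Sum>r<q. (-1) ^ r * C_coeff (int p) q r * Z_sum (2 * p + 3 * q - r) r)"
proof -
  \<comment> \<open>Since r < q, the exponent 2p + 3q - r exceeds 2p + 2q; in particular it is at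
    least 2, and each series converges.\<close>
  have "(\<lambda>n. \<Sum>r<q. (-1) ^ r * C_coeff (int p) q r * (Z_trunc r n / real n ^ (2 * p + 3 * q - r))) sums
      (\<Sum>r<q. (-1) ^ r * C_coeff (int p) q r * Z_sum (2 * p + 3 * q - r) r)"
    by (intro sums_sum sums_mult Z_sum_sums) auto
  moreover have "(\<Sum>r<q. (-1) ^ r * C_coeff (int p) q r * (Z_trunc r n / real n ^ (2 * p + 3 * q - r))) =
      fps_nth (pole_fps p n) (q - 1) / real n ^ (2 * p + 3 * q)" for n
  proof (cases "n = 0")
    case True
    have "(\<Sum>r<q. (-1) ^ r * C_coeff (int p) q r * (Z_trunc r n / real n ^ (2 * p + 3 * q - r))) = 0"
      by (rule sum.neutral) (auto simp: True zero_power)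
    then show ?thesis
      using True assms by simp
  next
    case False
    have "(\<Sum>r<q. (-1) ^ r * C_coeff (int p) q r * (Z_trunc r n / real n ^ (2 * p + 3 * q - r))) =
        (\<Sum>r<q. (-1) ^ r * C_coeff (int p) q r * real n ^ r * Z_trunc r n / real n ^ (2 * p + 3 * q))"
      using False by (intro sum.cong refl) (simp add: power_diff)
    then show ?thesis
      using sum_C_coeff_Z_trunc[of n q p] False assms by (simp flip: sum_divide_distrib)
  qed
  ultimately show ?thesis
    by simp
qed

lemma e_coeff_eq:
  assumes "q \<ge> 1"
  shows "e_coeff p q = of_real (\<Sum>r<q. (-1) ^ r * C_coeff (int p) q r * Z_sum (2 * p + 3 * q - r) r)"
proof (rule sums_unique2)
  show "(\<lambda>n. fps_nth (pole_fps p n) (q - 1) / of_nat n ^ (2 * p + 3 * q)) sums e_coeff p q"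
    by (rule e_coeff_sums) fact
  have eq: "fps_nth (pole_fps p n) (q - 1) / of_nat n ^ (2 * p + 3 * q) =
      complex_of_real (fps_nth (pole_fps p n) (q - 1) / real n ^ (2 * p + 3 * q))" for n
    by (subst pole_fps_of_real) (simp add: complex_fps_def)
  show "(\<lambda>n. fps_nth (pole_fps p n) (q - 1) / of_nat n ^ (2 * p + 3 * q)) sums
      complex_of_real (\<Sum>r<q. (-1) ^ r * C_coeff (int p) q r * Z_sum (2 * p + 3 * q - r) r)"
    unfolding eq by (rule sums_of_real[OF Z_sum_combination_sums[OF assms]])
qed

text \<open>For \<open>rs @ [k]\<close> of weight 2p + 3q, with r the sum of \<open>rs\<close>, the
  condition k > 2p + 2q says r < q. The depth bound follows, since entries 1 and 2 give
  \<open>length rs\<close> \<le> r.\<close>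

lemma sum_mzv_indices:
  fixes f :: "nat list \<Rightarrow> 'a :: comm_monoid_add"
  assumes "q \<ge> 1"
  shows "(\<Sum>r<q. \<Sum>rs\<in>{rs. set rs \<subseteq> {1, 2} \<and> sum_list rs = r}. f (rs @ [2 * p + 3 * q - r])) =
    (\<Sum>ks\<in>mzv_indices p q. f ks)"
proof -
  let ?I = "SIGMA r:{..<q}. {rs :: nat list. set rs \<subseteq> {1, 2} \<and> sum_list rs = r}"
  have "(\<Sum>r<q. \<Sum>rs\<in>{rs. set rs \<subseteq> {1, 2} \<and> sum_list rs = r}. f (rs @ [2 * p + 3 * q - r])) =
      (\<Sum>(r, rs)\<in>?I. f (rs @ [2 * p + 3 * q - r]))"
    by (subst sum.Sigma) (simp_all add: finite_Z_indices del: One_nat_def)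
  also have "\<dots> = (\<Sum>ks\<in>mzv_indices p q. f ks)"
  proof (rule sum.reindex_bij_witness[of _ "\<lambda>ks. (sum_list (butlast ks), butlast ks)"
        "\<lambda>(r, rs). rs @ [2 * p + 3 * q - r]"])
    have split: "sum_list ks = sum_list (butlast ks) + last ks" if "ks \<noteq> []" for ks :: "nat list"
      using that by (metis append_butlast_last_id sum_list.append sum_list.Cons sum_list.Nil add_0_right)
    fix ks assume ks: "ks \<in> mzv_indices p q"
    then have *: "ks \<noteq> []" "sum_list (butlast ks) + last ks = 2 * p + 3 * q" "2 * p + 2 * q < last ks"
      using split by (auto simp: mzv_indices_def)
    then have "2 * p + 3 * q - sum_list (butlast ks) = last ks"
      by linarith
    then show "(case (sum_list (butlast ks), butlast ks) of (r, rs) \<Rightarrow> rs @ [2 * p + 3 * q - r]) = ks"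
      using * by simp
    show "(sum_list (butlast ks), butlast ks) \<in> ?I"
      using * ks by (auto simp: mzv_indices_def)
  next
    have length_le: "length rs \<le> sum_list rs" if "set rs \<subseteq> {1, 2}" for rs :: "nat list"
      using that by (induction rs) auto
    fix x assume "x \<in> ?I"
    then obtain rs where x: "x = (sum_list rs, rs)" "sum_list rs < q" "set rs \<subseteq> {1, 2}"
      by auto
    with length_le[of rs] show "(case x of (r, rs) \<Rightarrow> rs @ [2 * p + 3 * q - r]) \<in> mzv_indices p q"
      by (simp add: mzv_indices_def)
  qed auto
  finally show ?thesis .
qed

theorem theorem1:
  fixes p q :: nat
  assumes "q \<ge> 1"
  shows "(\<exists>c :: nat list \<Rightarrow> int.
            e_coeff p q = (\<Sum>ks \<in> mzv_indices p q. of_int (c ks) * complex_of_real (mzv ks))) \<and>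
         e_coeff p q = complex_of_real
           (\<Sum>r = 0..q - 1. (-1) ^ r * C_coeff (int p) q r * Z_sum (2 * p + 3 * q - r) r)"
proof
  define d where "d r = \<lfloor>C_coeff (int p) q r\<rfloor>" for r
  have d: "C_coeff (int p) q r = of_int (d r)" for r
    using C_coeff_Ints[of p q r] by (simp add: d_def of_int_floor_cancel)
  \<comment> \<open>The integer has to depend on \<open>ks\<close> alone; \<open>butlast ks\<close>
    recovers \<open>rs\<close>, and its sum recovers r.\<close>
  define c where "c ks = (let rs = butlast ks; r = sum_list rs in (-1) ^ r * d r * 2 ^ count_list rs 1)"
    for ks :: "nat list"
  have "(\<Sum>r<q. (-1) ^ r * C_coeff (int p) q r * Z_sum (2 * p + 3 * q - r) r) =
      (\<Sum>r<q. \<Sum>rs\<in>{rs. set rs \<subseteq> {1, 2} \<and> sum_list rs = r}.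
        of_int (c (rs @ [2 * p + 3 * q - r])) * mzv (rs @ [2 * p + 3 * q - r]))"
    unfolding Z_sum_def sum_distrib_left
    by (intro sum.cong refl) (auto simp: c_def d Let_def)
  also have "\<dots> = (\<Sum>ks\<in>mzv_indices p q. of_int (c ks) * mzv ks)"
    by (rule sum_mzv_indices) fact
  finally have "e_coeff p q = of_real (\<Sum>ks\<in>mzv_indices p q. of_int (c ks) * mzv ks)"
    by (simp only: e_coeff_eq[OF assms])
  then have "e_coeff p q = (\<Sum>ks\<in>mzv_indices p q. of_int (c ks) * complex_of_real (mzv ks))"
    by simp
  then show "\<exists>c :: nat list \<Rightarrow> int.
      e_coeff p q = (\<Sum>ks \<in> mzv_indices p q. of_int (c ks) * complex_of_real (mzv ks))"
    by blast
  have "{0..q - 1} = {..<q}"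
    using assms by auto
  then show "e_coeff p q = complex_of_real
      (\<Sum>r = 0..q - 1. (-1) ^ r * C_coeff (int p) q r * Z_sum (2 * p + 3 * q - r) r)"
    using e_coeff_eq[OF assms] by simp
qed

end
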